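(* Let $l\in L$, let $\tilde D_l$ be the shifted GKZ operator and let $\tilde\Pi(x)$ be the rescaled rational $4$-form defined in the context. Then $$\tilde D_l\,\tilde\Pi(x)=-\sum_{i=1}^5\mathcal L_{\frac{w_i}{d}z_i\frac{\partial}{\partial z_i}}\alpha_i ,$$ where $\alpha_1,\dots,\alpha_5$ are the $d$-closed $4$-forms (depending on $l$) described in the context, and consequently $$\tilde D_l\,\tilde\Pi(x)=-d\beta_l,\qquad \beta_l=\sum_{i=1}^5\iota_{\frac{w_i}{d}z_i\frac{\partial}{\partial z_i}}\alpha_i .$$
   Context: Let $w_1,\dots,w_5$ be positive integers with $w_5=1$, put $d=w_1+\cdots+w_5$, and assume $w_i\mid d$ for all $i$ (Fermat type). In $\mathbb R^4$ let $v_1=(\frac d{w_1}-1,-1,-1,-1)$, $v_2=(-1,\frac d{w_2}-1,-1,-1)$, $v_3=(-1,-1,\frac d{w_3}-1,-1)$, $v_4=(-1,-1,-1,\frac d{w_4}-1)$, $v_5=(-1,-1,-1,-1)$, and let $\Delta^*$ be the convex hull of $v_1^*=(1,0,0,0)$, $v_2^*=(0,1,0,0)$, $v_3^*=(0,0,1,0)$, $v_4^*=(0,0,0,1)$, $v_5^*=(-w_1,-w_2,-w_3,-w_4)$. Let $v_0^*=0,v_1^*,\dots,v_5^*,v_6^*,\dots$ be all the integral points of $\Delta^*$, and let $a=(a_0,a_1,a_2,\dots)$ be parameters indexed by these points (nonzero, with branches of logarithms and fractional powers chosen locally). In homogeneous coordinates $z_1,\dots,z_5$ of weights $w_1,\dots,w_5$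 put $\Omega_0=\sum_{\rho=1}^5(-1)^{\rho-1}w_\rho z_\rho\,dz_1\wedge\cdots\widehat{dz_\rho}\cdots\wedge dz_5$ and $$\Pi(a)=\frac{\Omega_0}{\sum_{k}a_k\prod_{\rho=1}^5z_\rho^{\langle v_k^*,v_\rho\rangle+1}} .$$ Let $\phi_1$ be the automorphism $z_\rho\mapsto(a_0/a_\rho)^{w_\rho/d}z_\rho$, $1\le\rho\le5$, and set $\tilde\Pi(x)=a_0\,\phi_1^*\Pi(a)$. (It depends on $a$ only through the variables $x_k=(-1)^{l^{(k)}_0}a^{l^{(k)}}$, where $\{l^{(k)}\}$ is a basis of the lattice $L$ below.) Let $L=\{l=(l_0,l_1,\dots)\text{ integral}:\ \sum_il_i\bar v_i^*=0\}$ with $\bar v_i^*=(1,v_i^* )$, and $a^l=\prod_ia_i^{l_i}$. For $l\in L$ set (with products over empty ranges equal to $1$) $$\tilde D_l=\prod_{j=1}^{l_0}\Big(a_0\frac{\partial}{\partial a_0}-j\Big)\prod_{i\ne0,\,l_i>0}\ \prod_{j=0}^{l_i-1}\Big(a_i\frac{\partial}{\partial a_i}-j\Big)-a^l\prod_{j=1}^{-l_0}\Big(a_0\frac{\partial}{\partial a_0}-j\Big)\prod_{i\neq0,\,l_i<0}\ \prod_{j=0}^{-l_i-1}\Big(a_i\frac{\partial}{\partial a_i}-j\Big).$$ (Thus $\tilde D_la_0=a_0\{\prod_{l_i>0}a_i^{l_i}\partial_{a_i}^{l_i}-a^l\prod_{l_i<0}a_i^{-l_i}\partial_{a_i}^{-l_i}\}$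 is the standard GKZ operator up to a factor.) The exterior derivative $d$, contraction $\iota$ and Lie derivative $\mathcal L$ act in the variables $z$ only. The forms $\alpha_i$: let $\hat D_l$ be obtained from $\tilde D_l$ by replacing each $a_i\frac{\partial}{\partial a_i}$ with $1\le i\le5$ by $a_i\frac{\partial}{\partial a_i}+\mathcal L_{\frac{w_i}dz_i\frac{\partial}{\partial z_i}}$, leaving all other $a_i\frac{\partial}{\partial a_i}$ (including $i=0$) unchanged. The Lie derivatives $\mathcal L_{\frac{w_i}dz_i\partial_{z_i}}$ commute with all other operators occurring, so expanding the products and pulling out, in each term containing Lie derivatives, one such factor to the left gives a decomposition $\hat D_l=\tilde D_l+\sum_{i=1}^5\mathcal L_{\frac{w_i}dz_i\partial_{z_i}}A_{l,i}$ with explicit operators $A_{l,i}$ built from $a^l$, the $a_j\frac{\partial}{\partial a_j}$ and the Lie derivatives. Then $\alpha_i:=A_{l,i}\tilde\Pi(x)$. *)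

theory Defs
  imports "HOL-Analysis.Analysis"
begin

text \<open>
  Everything is indexed as in the mathematics: the homogeneous coordinates are
  $z_1,\dots,z_5$, the parameters $a_0,\dots,a_N$. Points of both spaces are functions
  \<open>nat \<Rightarrow> complex\<close> of which only these entries are ever used.
\<close>

type_synonym point = "nat \<Rightarrow> complex"


section \<open>The polytope and its integral points\<close>

definition total_wt :: "(nat \<Rightarrow> nat) \<Rightarrow> nat" where
  "total_wt w = (\<Sum>i=1..5. w i)"

definition fermat_weights :: "(nat \<Rightarrow> nat) \<Rightarrow> bool" where
  "fermat_weights w \<longleftrightarrow> (\<forall>i\<in>{1..5}. 0 < w i \<and> w i dvd total_wt w) \<and> w 5 = 1"

definition vert :: "(nat \<Rightarrow> nat) \<Rightarrow> nat \<Rightarrow> real ^ 4" where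
  "vert w \<rho> = (let q = real (total_wt w) / real (w \<rho>) in
     if \<rho> = 1 then vector [q - 1, -1, -1, -1]
     else if \<rho> = 2 then vector [-1, q - 1, -1, -1]
     else if \<rho> = 3 then vector [-1, -1, q - 1, -1]
     else if \<rho> = 4 then vector [-1, -1, -1, q - 1]
     else vector [-1, -1, -1, -1])"

definition dual_vert :: "(nat \<Rightarrow> nat) \<Rightarrow> nat \<Rightarrow> real ^ 4" where
  "dual_vert w i =
     (if i = 1 then vector [1, 0, 0, 0]
      else if i = 2 then vector [0, 1, 0, 0]
      else if i = 3 then vector [0, 0, 1, 0]
      else if i = 4 then vector [0, 0, 0, 1]
      else vector [- real (w 1), - real (w 2), - real (w 3), - real (w 4)])"

definition dual_polytope :: "(nat \<Rightarrow> nat) \<Rightarrow> (real ^ 4) set" where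
  "dual_polytope w = convex hull (dual_vert w ` {1..5})"

definition enumerates_integral_points ::
    "(nat \<Rightarrow> nat) \<Rightarrow> nat \<Rightarrow> (nat \<Rightarrow> real ^ 4) \<Rightarrow> bool" where
  "enumerates_integral_points w N v \<longleftrightarrow>
     5 \<le> N \<and>
     bij_betw v {0..N} {x \<in> dual_polytope w. \<forall>j. x $ j \<in> \<int>} \<and>
     v 0 = 0 \<and> (\<forall>i\<in>{1..5}. v i = dual_vert w i)"

definition relation_lattice :: "nat \<Rightarrow> (nat \<Rightarrow> real ^ 4) \<Rightarrow> (nat \<Rightarrow> int) set" where
  "relation_lattice N v = {l. (\<Sum>i\<le>N. real_of_int (l i) *\<^sub>R (1 :: real, v i)) = 0}"

definition lmonom :: "nat \<Rightarrow> (nat \<Rightarrow> int) \<Rightarrow> point \<Rightarrow> complex" where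
  "lmonom N l a = (\<Prod>i\<le>N. a i powi l i)"


section \<open>Differential forms in the coordinates $z_1,\dots,z_5$\<close>

definition pd :: "nat \<Rightarrow> (point \<Rightarrow> complex) \<Rightarrow> point \<Rightarrow> complex" where
  "pd i f x = deriv (\<lambda>t. f (x(i := t))) (x i)"

text \<open>
  A $k$-form $\omega$ is represented by its components on the coordinate vector fields:
  \<open>\<omega> [i\<^sub>1, \<dots>, i\<^sub>k] z\<close> is $\omega_z(\partial_{i_1},\dots,\partial_{i_k})$.
  Two $k$-forms are equal iff they agree on all index lists in \<open>idx k\<close>.
\<close>

type_synonym form = "nat list \<Rightarrow> point \<Rightarrow> complex"
type_synonym vfield = "nat \<Rightarrow> point \<Rightarrow> complex"

definition idx :: "nat \<Rightarrow> nat list set" where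
  "idx k = {I. length I = k \<and> set I \<subseteq> {1..5}}"

text \<open>
  The components of $dz_{j_1}\wedge\dots\wedge dz_{j_k}$, that is $\det(\delta_{j_p i_q})$.
\<close>

definition dz_wedge :: "nat list \<Rightarrow> nat list \<Rightarrow> complex" where
  "dz_wedge J I =
     (if length I = length J
      then \<Sum>\<sigma> | \<sigma> permutes {..<length J}.
             of_int (sign \<sigma>) * (\<Prod>p<length J. if J ! p = I ! \<sigma> p then 1 else 0)
      else 0)"

definition ext_d :: "form \<Rightarrow> form" where
  "ext_d \<omega> I z = (\<Sum>p<length I. (-1) ^ p * pd (I ! p) (\<omega> (take p I @ drop (Suc p) I)) z)"

definition contract :: "vfield \<Rightarrow> form \<Rightarrow> form" where
  "contract X \<omega> I z = (\<Sum>m=1..5. X m z * \<omega> (m # I) z)"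

text \<open>
  $(\mathcal L_X\omega)(\partial_{i_1},\dots,\partial_{i_k})
    = X(\omega(\partial_{i_1},\dots,\partial_{i_k}))
      - \sum_p \omega(\dots,[X,\partial_{i_p}],\dots)$,
  where $[X,\partial_{i}] = -\sum_m (\partial_{i}X_m)\,\partial_m$.
\<close>

definition lie :: "vfield \<Rightarrow> form \<Rightarrow> form" where
  "lie X \<omega> I z =
     (\<Sum>m=1..5. X m z * pd m (\<omega> I) z)
     + (\<Sum>p<length I. \<Sum>m=1..5. pd (I ! p) (X m) z * \<omega> (I[p := m]) z)"

definition pullback :: "(point \<Rightarrow> point) \<Rightarrow> form \<Rightarrow> form" where
  "pullback \<phi> \<omega> J z =
     (\<Sum>I\<in>idx (length J). (\<Prod>p<length J. pd (J ! p) (\<lambda>y. \<phi> y (I ! p)) z) * \<omega> I (\<phi> z))"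


section \<open>The form $\Pi$ and its rescaling\<close>

definition Omega0 :: "(nat \<Rightarrow> nat) \<Rightarrow> form" where
  "Omega0 w I z =
     (\<Sum>\<rho>=1..5. (-1) ^ (\<rho> - 1) * of_nat (w \<rho>) * z \<rho> * dz_wedge (remove1 \<rho> [1..<6]) I)"

text \<open>
  The exponents $\langle v_k^*,v_\rho\rangle+1$ are nonnegative integers; the floor only
  converts their type.
\<close>

definition denom :: "(nat \<Rightarrow> nat) \<Rightarrow> nat \<Rightarrow> (nat \<Rightarrow> real ^ 4) \<Rightarrow> point \<Rightarrow> point \<Rightarrow> complex" where
  "denom w N v a z =
     (\<Sum>k\<le>N. a k * (\<Prod>\<rho>=1..5. z \<rho> powi \<lfloor>v k \<bullet> vert w \<rho> + 1\<rfloor>))"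

definition Pi_form :: "(nat \<Rightarrow> nat) \<Rightarrow> nat \<Rightarrow> (nat \<Rightarrow> real ^ 4) \<Rightarrow> point \<Rightarrow> form" where
  "Pi_form w N v a I z = Omega0 w I z / denom w N v a z"

text \<open>
  \<open>lg \<rho>\<close> is a branch, on the parameter domain \<open>U\<close>, of the logarithm of $a_0/a_\rho$; it
  determines the fractional powers of $a_0/a_\rho$.
\<close>

definition log_branches :: "point set \<Rightarrow> (nat \<Rightarrow> point \<Rightarrow> complex) \<Rightarrow> bool" where
  "log_branches U lg \<longleftrightarrow>
     (\<forall>\<rho>\<in>{1..5}. continuous_on U (lg \<rho>) \<and> (\<forall>a\<in>U. exp (lg \<rho> a) = a 0 / a \<rho>))"

definition phi1 :: "(nat \<Rightarrow> nat) \<Rightarrow> (nat \<Rightarrow> point \<Rightarrow> complex) \<Rightarrow> point \<Rightarrow> point \<Rightarrow> point" where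
  "phi1 w lg a z = (\<lambda>\<rho>. exp (of_nat (w \<rho>) / of_nat (total_wt w) * lg \<rho> a) * z \<rho>)"

definition Pi_tilde ::
    "(nat \<Rightarrow> nat) \<Rightarrow> nat \<Rightarrow> (nat \<Rightarrow> real ^ 4) \<Rightarrow> (nat \<Rightarrow> point \<Rightarrow> complex) \<Rightarrow> point \<Rightarrow> form" where
  "Pi_tilde w N v lg a I z = a 0 * pullback (phi1 w lg a) (Pi_form w N v a) I z"


section \<open>Operators on families of forms\<close>

text \<open>
  A family assigns a form in $z$ to each parameter point $a$; operators act on families.
\<close>

type_synonym family = "point \<Rightarrow> form"

definition compose_ops :: "(family \<Rightarrow> family) list \<Rightarrow> family \<Rightarrow> family" where
  "compose_ops ops = foldr (\<circ>) ops id"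

definition theta_shift :: "nat \<times> nat \<Rightarrow> family \<Rightarrow> family" where
  "theta_shift = (\<lambda>(i, j) F a I z. a i * pd i (\<lambda>b. F b I z) a - of_nat j * F a I z)"

definition euler_field :: "(nat \<Rightarrow> nat) \<Rightarrow> nat \<Rightarrow> vfield" where
  "euler_field w i m z = (if m = i then of_nat (w i) / of_nat (total_wt w) * z i else 0)"

definition lie_op :: "(nat \<Rightarrow> nat) \<Rightarrow> nat \<Rightarrow> family \<Rightarrow> family" where
  "lie_op w i F a = lie (euler_field w i) (F a)"

text \<open>
  The pairs $(i,j)$ that index the factors $a_i\partial_{a_i}-j$ of the first product in
  $\tilde D_l$. The second product is the first one for $-l$.
\<close>

definition factors :: "nat \<Rightarrow> (nat \<Rightarrow> int) \<Rightarrow> (nat \<times> nat) list" where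
  "factors N l =
     map (Pair 0) [1..<Suc (nat (l 0))]
     @ concat (map (\<lambda>i. map (Pair i) [0..<nat (l i)]) [1..<Suc N])"

definition gkz_half :: "nat \<Rightarrow> (nat \<Rightarrow> int) \<Rightarrow> family \<Rightarrow> family" where
  "gkz_half N l = compose_ops (map theta_shift (factors N l))"

definition D_tilde :: "nat \<Rightarrow> (nat \<Rightarrow> int) \<Rightarrow> family \<Rightarrow> family" where
  "D_tilde N l F a I z =
     gkz_half N l F a I z - lmonom N l a * gkz_half N (\<lambda>i. - l i) F a I z"

text \<open>
  In $\hat D_l$ every factor $(i,j)$ with $1\le i\le 5$ becomes
  $(a_i\partial_{a_i}-j)+\mathcal L_i$, with $\mathcal L_i$ the Lie derivative along
  $\frac{w_i}{d}z_i\partial_{z_i}$. Expanding the first product gives one term for each set $S$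
  of such factors, namely the term in which exactly the factors in $S$ contribute
  $\mathcal L_i$. The term $S=\emptyset$ belongs to $\tilde D_l$. From each other term one
  Lie derivative, that of the factor \<open>c S \<in> S\<close>, is pulled out to the left; \<open>A_half\<close> collects
  what remains of the terms from which $\mathcal L_i$ has been pulled out. Since the factors
  of $-l$ with $i\ge1$ are disjoint from those of $l$, one choice function \<open>c\<close> allows
  independent choices in the two products.
\<close>

definition lie_factors :: "nat \<Rightarrow> (nat \<Rightarrow> int) \<Rightarrow> (nat \<times> nat) set" where
  "lie_factors N l = {p \<in> set (factors N l). fst p \<in> {1..5}}"

definition A_half ::
    "(nat \<Rightarrow> nat) \<Rightarrow> nat \<Rightarrow> ((nat \<times> nat) set \<Rightarrow> nat \<times> nat) \<Rightarrow> (nat \<Rightarrow> int) \<Rightarrow> nat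
      \<Rightarrow> family \<Rightarrow> family" where
  "A_half w N c l i F a I z =
     (\<Sum>S | S \<subseteq> lie_factors N l \<and> S \<noteq> {} \<and> fst (c S) = i.
        compose_ops
          (map (\<lambda>p. if p \<in> S then lie_op w (fst p) else theta_shift p)
             (remove1 (c S) (factors N l)))
          F a I z)"

definition A_op ::
    "(nat \<Rightarrow> nat) \<Rightarrow> nat \<Rightarrow> ((nat \<times> nat) set \<Rightarrow> nat \<times> nat) \<Rightarrow> (nat \<Rightarrow> int) \<Rightarrow> nat
      \<Rightarrow> family \<Rightarrow> family" where
  "A_op w N c l i F a I z =
     A_half w N c l i F a I z - lmonom N l a * A_half w N c (\<lambda>j. - l j) i F a I z"

definition alpha ::
    "(nat \<Rightarrow> nat) \<Rightarrow> nat \<Rightarrow> (nat \<Rightarrow> real ^ 4) \<Rightarrow> (nat \<Rightarrow> point \<Rightarrow> complex)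
      \<Rightarrow> ((nat \<times> nat) set \<Rightarrow> nat \<times> nat) \<Rightarrow> (nat \<Rightarrow> int) \<Rightarrow> nat \<Rightarrow> family" where
  "alpha w N v lg c l i = A_op w N c l i (Pi_tilde w N v lg)"

definition beta ::
    "(nat \<Rightarrow> nat) \<Rightarrow> nat \<Rightarrow> (nat \<Rightarrow> real ^ 4) \<Rightarrow> (nat \<Rightarrow> point \<Rightarrow> complex)
      \<Rightarrow> ((nat \<times> nat) set \<Rightarrow> nat \<times> nat) \<Rightarrow> (nat \<Rightarrow> int) \<Rightarrow> family" where
  "beta w N v lg c l a I z =
     (\<Sum>i=1..5. contract (euler_field w i) (alpha w N v lg c l i a) I z)"

end

theory Submission
  imports Defs
begin

text \<open>
Write $\Omega_0=\iota_E\,\mathrm{vol}$ with $E=\sum_\rho w_\rho z_\rho\partial_{z_\rho}$, let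
$\lambda_\rho=(a_0/a_\rho)^{w_\rho/d}$, and put $y_\rho=\lambda_\rho z_\rho$. Then
$\tilde\Pi=a_0\prod_\rho\lambda_\rho\,\Omega_0/Q$ with $Q=\sum_k T_k$ and
$T_k=a_k\prod_\rho y_\rho^{\langle v_k^*,v_\rho\rangle+1}$.

Why the first identity holds. The rescaling lets $a_1,\dots,a_5$ act on the coordinates: by the
chain rule, pulling back $a_i\partial_{a_i}$ for $1\le i\le5$ gives
$a_i\partial_{a_i}+\mathcal L_i$, where $\mathcal L_i$ is the Lie derivative along
$\frac{w_i}{d}z_i\partial_{z_i}$. For $i=0$ it gives $a_0\partial_{a_0}-\sum_i\mathcal L_i$, and
$\sum_i\mathcal L_i$ kills every form that occurs, since all of them have degree zero. So
$\hat D_l\tilde\Pi$ is the pullback of $\tilde D_l(a_0\Pi)$, and this vanishes as in the classical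
case: the first product of factors turns $1/Q$ into
$\partial_T^{l^+}$-derivatives, the second one into $\partial_T^{l^-}$-derivatives, and the lattice
relation says that the two results differ exactly by the factor $a^l$. Expanding $\hat D_l$ and
pulling one Lie derivative out of every term but the first gives
$\tilde D_l\tilde\Pi=-\sum_i\mathcal L_i\alpha_i$.

Why the rest follows. Every $\alpha_i$ is $f\,\Omega_0$ for a function $f$ of such a degree that
$\sum_i\mathcal L_i(f\Omega_0)=0$. If $\sum_i\mathcal L_i(f\Omega_0)=g\,\Omega_0$, then the exterior derivative
of $f\,\Omega_0$ is a constant multiple of $g\,\mathrm{vol}$. So the forms $\alpha_i$ are closed, and
Cartan's formula turns $\mathcal L_i\alpha_i$ into the exterior derivative of the contraction of
$\alpha_i$.

How derivatives of arbitrary order are controlled. All forms that occur are $f\,\Omega_0$ with $f$ in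
the span of the functions
$\Gamma_m=a_0\prod_\rho\lambda_\rho\cdot T^m\partial_T^m(1/Q)$, indexed by exponent vectors $m$
(\<open>pole\<close>). The derivations $a_i\partial_{a_i}$ and $\frac{w_i}{d}z_i\partial_{z_i}$ multiply every $T_k$ by a constant
$\alpha_k$, hence each $a_i\partial_{a_i}-j$ and each $\mathcal L_i$ sends $\Gamma_m$ to
$(\kappa+\sum_k\alpha_km_k)\Gamma_m+\sum_k\alpha_k\Gamma_{m+e_k}$ (\<open>euler_op\<close>). Operators of this
shape commute on the span (\<open>euler_op_commute\<close>), which replaces any appeal to the symmetry of mixed
partial derivatives; the corrected factor for $(i,j)$ acts by
$\Gamma_m\mapsto(m_i-j)\Gamma_m+\Gamma_{m+e_i}$, with $m_0+1$ in place of $m_i$ for $i=0$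
(\<open>euler_op_theta_hat\<close>), so the whole product raises $\Gamma_0$ to $\Gamma_{l^+}$
(\<open>foldr_raise_factors\<close>), and \<open>pole_lattice\<close> compares $\Gamma_{l^+}$ with $\Gamma_{l^-}$.
\<close>


section \<open>Alternating functions and the volume form\<close>

text \<open>
Sign change under adjacent transpositions only: this is the form in which the property is used when
an index is moved through a list, and all other permutations follow from it.
\<close>

definition alternating :: "(nat list \<Rightarrow> complex) \<Rightarrow> bool" where
  "alternating f \<longleftrightarrow> (\<forall>xs x y ys. f (xs @ x # y # ys) = - f (xs @ y # x # ys))"

lemma alternating_cmult: "alternating f \<Longrightarrow> alternating (\<lambda>I. c * f I)"
  unfolding alternating_def by (metis mult_minus_right)

lemma alternating_Cons: "alternating f \<Longrightarrow> alternating (\<lambda>I. f (x # I))"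
  unfolding alternating_def by (metis append_Cons)

text \<open>
Moving an index past \<open>ps\<close> takes one adjacent transposition for each entry of \<open>ps\<close>.
\<close>

lemma alternating_move:
  assumes "alternating f"
  shows "f (xs @ m # ps @ ys) = (-1) ^ length ps * f (xs @ ps @ m # ys)"
proof (induction ps arbitrary: xs)
  case (Cons p ps)
  have "f (xs @ m # p # (ps @ ys)) = - f (xs @ p # m # (ps @ ys))"
    using assms unfolding alternating_def by blast
  with Cons[of "xs @ [p]"] show ?case by simp
qed simp

lemma alternating_swap:
  assumes "alternating f"
  shows "f (xs @ x # ys @ y # zs) = - f (xs @ y # ys @ x # zs)"
proof -
  have "f ((xs @ ys) @ x # y # zs) = - f ((xs @ ys) @ y # x # zs)"
    using assms unfolding alternating_def by blast
  then show ?thesis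
    using alternating_move[OF assms, of xs x ys "y # zs"]
      alternating_move[OF assms, of xs y ys "x # zs"] by simp
qed

lemma alternating_repeated:
  assumes "alternating f" "\<not> distinct I"
  shows "f I = 0"
proof -
  obtain xs y ys zs where "I = xs @ [y] @ ys @ [y] @ zs"
    using not_distinct_decomp[OF assms(2)] by blast
  then have "f I = - f I"
    using alternating_swap[OF assms(1), of xs y ys y zs] by simp
  then show ?thesis by simp
qed

text \<open>
The signs $(-1)^p$ in the exterior derivative come from bringing the $p$-th slot to the front. This
identity turns them into a plain replacement of the $p$-th index.
\<close>

lemma alternating_replace:
  assumes "alternating f" "p < length I"
  shows "f (I[p := m]) = (-1) ^ p * f (m # take p I @ drop (Suc p) I)"
  using alternating_move[OF assms(1), of "[]" m "take p I" "drop (Suc p) I"] assms(2)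
  by (simp add: upd_conv_take_nth_drop power_mult_distrib[symmetric] mult.assoc[symmetric])

text \<open>
An alternating function is determined on all rearrangements of a list by its value on that list:
move the entries to their places one after another, starting with the head.
\<close>

lemma alternating_eqI:
  assumes "alternating f" "alternating g" "f J = g J" "mset I = mset J"
  shows "f I = g I"
  using assms
proof (induction J arbitrary: f g I)
  case (Cons x J)
  have "x \<in> set I" using Cons.prems(4) by (metis list.set_intros(1) mset_eq_setD)
  then obtain as bs where I: "I = as @ x # bs" by (auto dest: split_list)
  have "f (x # as @ bs) = g (x # as @ bs)"
    using Cons.IH[OF alternating_Cons alternating_Cons, OF Cons.prems(1,2), where I = "as @ bs"]
      Cons.prems(3,4) I by simp
  moreover have "h I = (-1) ^ length as * h (x # as @ bs)" if "alternating h" for h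
    using alternating_move[OF that, of "[]" x as bs] I
    by (simp add: power_mult_distrib[symmetric] mult.assoc[symmetric])
  ultimately show ?case using Cons.prems(1,2) by metis
qed simp

text \<open>
Composing the summation permutation with the transposition reindexes the determinant sum and
reverses every sign.
\<close>

lemma alternating_dz_wedge: "alternating (dz_wedge J)"
  unfolding alternating_def
proof (intro allI)
  fix xs ys :: "nat list" and x y :: nat
  let ?I = "xs @ x # y # ys" and ?I' = "xs @ y # x # ys" and ?k = "length xs"
  let ?t = "Transposition.transpose ?k (Suc ?k)"
  show "dz_wedge J ?I = - dz_wedge J ?I'"
  proof (cases "length ?I = length J")
    case True
    let ?n = "length J"
    have t: "?t permutes {..<?n}"
      using True by (intro permutes_swap_id) auto
    have nth: "?I ! ?t q = ?I' ! q" for q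
      by (auto simp: Transposition.transpose_def nth_append nth_Cons split: nat.splits)
    have sg: "sign (?t \<circ> \<sigma>) = - sign \<sigma>" if "\<sigma> permutes {..<?n}" for \<sigma>
      using that t by (subst sign_compose)
        (auto intro: permutation_permutes[THEN iffD2] simp: sign_swap_id)
    have "dz_wedge J ?I = (\<Sum>\<sigma> | \<sigma> permutes {..<?n}.
             of_int (sign \<sigma>) * (\<Prod>p<?n. if J ! p = ?I ! \<sigma> p then 1 else 0))"
      using True by (simp add: dz_wedge_def)
    also have "\<dots> = (\<Sum>\<sigma> | \<sigma> permutes {..<?n}.
             of_int (sign (?t \<circ> \<sigma>)) * (\<Prod>p<?n. if J ! p = ?I ! (?t \<circ> \<sigma>) p then 1 else 0))"
      by (rule setum_permutations_compose_left[OF t])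
    also have "\<dots> = (\<Sum>\<sigma> | \<sigma> permutes {..<?n}.
             - (of_int (sign \<sigma>) * (\<Prod>p<?n. if J ! p = ?I' ! \<sigma> p then 1 else 0)))"
      by (intro sum.cong refl) (simp add: sg nth del: comp_apply add: o_def[of _ _, THEN fun_cong])
    also have "\<dots> = - dz_wedge J ?I'"
      using True by (simp add: dz_wedge_def sum_negf)
    finally show ?thesis .
  qed (simp add: dz_wedge_def)
qed

lemma dz_wedge_nonzeroD:
  assumes "dz_wedge J I \<noteq> 0"
  shows "mset I = mset J"
proof -
  have len: "length I = length J"
    using assms by (auto simp: dz_wedge_def split: if_splits)
  then have "(\<Sum>\<sigma> | \<sigma> permutes {..<length J}. of_int (sign \<sigma>)
      * (\<Prod>p<length J. if J ! p = I ! \<sigma> p then 1 else 0)) \<noteq> (0 :: complex)"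
    using assms by (simp add: dz_wedge_def)
  then obtain \<sigma> where \<sigma>: "\<sigma> permutes {..<length J}"
    and nz: "(\<Prod>p<length J. if J ! p = I ! \<sigma> p then 1 else 0) \<noteq> (0 :: complex)"
    by (metis (mono_tags, lifting) mem_Collect_eq mult_zero_right sum.neutral)
  then have "J ! p = I ! \<sigma> p" if "p < length J" for p
    using that by (auto simp: prod_zero_iff split: if_splits)
  then have "permute_list \<sigma> I = J"
    using len by (intro nth_equalityI) (auto simp: permute_list_def)
  then show ?thesis using mset_permute_list[of \<sigma> I] \<sigma> len by simp
qed

lemma dz_wedge_self:
  assumes "distinct J"
  shows "dz_wedge J J = 1"
proof -
  have "(\<Prod>p<length J. if J ! p = J ! \<sigma> p then 1 else 0) = (if \<sigma> = id then 1 else (0::complex))"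
    if \<sigma>: "\<sigma> permutes {..<length J}" for \<sigma>
  proof (cases "\<sigma> = id")
    case False
    then obtain p where p: "\<sigma> p \<noteq> p" by (metis eq_id_iff)
    then have "p < length J" using \<sigma> by (auto simp: permutes_def)
    moreover have "\<sigma> p < length J" using \<sigma> calculation permutes_in_image by fastforce
    ultimately have "J ! p \<noteq> J ! \<sigma> p" using assms p by (simp add: nth_eq_iff_index_eq)
    then show ?thesis using False \<open>p < length J\<close> by (auto intro!: prod_zero)
  qed simp
  then have "dz_wedge J J = (\<Sum>\<sigma> | \<sigma> permutes {..<length J}. if \<sigma> = id then 1 else 0)"
    unfolding dz_wedge_def by (auto intro!: sum.cong)
  also have "\<dots> = 1"
    using permutes_id[of "{..<length J}"]
    by (subst sum.delta) (auto simp: finite_permutations)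
  finally show ?thesis .
qed

text \<open>
The components of $dz_1\wedge\dots\wedge dz_5$.
\<close>

definition vol :: "nat list \<Rightarrow> complex" where
  "vol = dz_wedge [1..<6]"

lemma alternating_vol: "alternating vol"
  unfolding vol_def by (rule alternating_dz_wedge)

lemma vol_nonzeroD: "vol I \<noteq> 0 \<Longrightarrow> mset I = mset [1..<6]"
  unfolding vol_def by (rule dz_wedge_nonzeroD)

text \<open>
$\Omega_0$ is the contraction of the volume form with the weighted Euler field. Both
$(-1)^{\rho-1}dz_1\wedge\cdots\widehat{dz_\rho}\cdots\wedge dz_5$ and $\iota_{\partial_\rho}\mathrm{vol}$ are
alternating and vanish off the rearrangements of the complement of $\rho$, so it suffices to compare
them on the sorted list; there the sign is that of moving $\rho$ to the front.
\<close>

lemma Omega0_eq_contract_vol: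
  "Omega0 w I z = (\<Sum>\<rho>=1..5. of_nat (w \<rho>) * z \<rho> * vol (\<rho> # I))"
proof -
  have "(-1) ^ (\<rho> - 1) * dz_wedge (remove1 \<rho> [1..<6]) I = vol (\<rho> # I)" if \<rho>: "\<rho> \<in> {1..5}" for \<rho>
  proof (cases "mset (\<rho> # I) = mset [1..<6]")
    case True
    let ?J = "remove1 \<rho> [1..<6]"
    have mem: "\<rho> \<in> set [1..<6]" using \<rho> by auto
    have J: "?J = take (\<rho> - 1) [1..<6] @ drop (Suc (\<rho> - 1)) [1..<6]"
    proof -
      have "[1..<6] = [1..<\<rho>] @ \<rho> # [Suc \<rho>..<6]"
        using \<rho> upt_add_eq_append[of 1 \<rho> "6 - \<rho>"] by (simp add: upt_conv_Cons)
      then have "?J = [1..<\<rho>] @ [Suc \<rho>..<6]" by (simp add: remove1_append)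
      then show ?thesis using \<rho> by (simp add: take_upt drop_upt)
    qed
    have upd: "[1..<6][\<rho> - 1 := \<rho>] = [1..<6]"
      using \<rho> by (intro nth_equalityI) (auto simp: nth_list_update simp del: upt_Suc)
    have "mset I = mset ?J" using True mem
      by (metis add_mset_remove_trivial mset.simps(2) mset_remove1)
    moreover have "alternating (\<lambda>I. (-1) ^ (\<rho> - 1) * dz_wedge ?J I)"
      by (intro alternating_cmult alternating_dz_wedge)
    moreover have "alternating (\<lambda>I. vol (\<rho> # I))"
      by (intro alternating_Cons alternating_vol)
    moreover have "(-1) ^ (\<rho> - 1) * dz_wedge ?J ?J = vol (\<rho> # ?J)"
    proof -
      let ?s = "(-1) ^ (\<rho> - 1) :: complex"
      have "vol ([1..<6][\<rho> - 1 := \<rho>]) = ?s * vol (\<rho> # ?J)"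
        unfolding J using \<rho>
        by (intro alternating_replace[OF alternating_vol, of "\<rho> - 1" "[1..<6]"]) auto
      then have "1 = ?s * vol (\<rho> # ?J)"
        by (simp only: upd vol_def dz_wedge_self distinct_upt)
      then have "?s * 1 = (?s * ?s) * vol (\<rho> # ?J)"
        by (simp only: mult.assoc)
      moreover have "?s * ?s = 1"
        by (simp add: power_mult_distrib[symmetric])
      moreover have "dz_wedge ?J ?J = 1"
        by (intro dz_wedge_self distinct_remove1 distinct_upt)
      ultimately show ?thesis by (simp only: mult_1)
    qed
    ultimately show ?thesis
      using alternating_eqI[of "\<lambda>I. (-1) ^ (\<rho> - 1) * dz_wedge ?J I" "\<lambda>I. vol (\<rho> # I)" ?J I]
      by blast
  next
    case False
    have "dz_wedge (remove1 \<rho> [1..<6]) I = 0"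
    proof (rule ccontr)
      assume "\<not> ?thesis"
      then have "mset I = mset (remove1 \<rho> [1..<6])" by (rule dz_wedge_nonzeroD)
      moreover have "\<rho> \<in># mset [1..<6]" using \<rho> by auto
      ultimately have "mset (\<rho> # I) = mset [1..<6]" by (simp del: upt_Suc)
      with False show False by simp
    qed
    moreover have "vol (\<rho> # I) = 0" using False vol_nonzeroD by blast
    ultimately show ?thesis by simp
  qed
  then show ?thesis unfolding Omega0_def
    by (intro sum.cong refl) (metis mult.assoc mult.left_commute)
qed

lemma alternating_Omega0: "alternating (\<lambda>I. Omega0 w I z)"
  unfolding Omega0_eq_contract_vol alternating_def
proof (intro allI)
  fix xs ys :: "nat list" and x y :: nat
  have "vol (\<rho> # xs @ x # y # ys) = - vol (\<rho> # xs @ y # x # ys)" for \<rho>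
    using alternating_Cons[OF alternating_vol] unfolding alternating_def by blast
  then show "(\<Sum>\<rho>=1..5. of_nat (w \<rho>) * z \<rho> * vol (\<rho> # xs @ x # y # ys))
      = - (\<Sum>\<rho>=1..5. of_nat (w \<rho>) * z \<rho> * vol (\<rho> # xs @ y # x # ys))"
    by (simp only: mult_minus_right sum_negf)
qed


section \<open>Calculus of differential forms\<close>

lemma pd_eqI:
  assumes "\<forall>\<^sub>F t in nhds (x i). f (x(i := t)) = g t" "(g has_field_derivative D) (at (x i))"
  shows "pd i f x = D"
proof -
  have "((\<lambda>t. f (x(i := t))) has_field_derivative D) (at (x i))"
    using assms(2) DERIV_cong_ev[OF refl assms(1) refl] by blast
  then show ?thesis unfolding pd_def by (rule DERIV_imp_deriv)
qed

lemma pd_DERIV: "((\<lambda>t. f (x(i := t))) has_field_derivative D) (at (x i)) \<Longrightarrow> pd i f x = D"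
  unfolding pd_def by (rule DERIV_imp_deriv)

lemma fun_upd_coord_DERIV:
  "((\<lambda>t. (x(i := t)) j) has_field_derivative (if j = i then 1 else 0)) (at (x i :: complex))"
  by (cases "j = i") auto

lemma pd_euler_field:
  "pd j (euler_field w i m) z = (if m = i \<and> j = i then of_nat (w i) / of_nat (total_wt w) else 0)"
proof (cases "m = i")
  case True
  let ?c = "of_nat (w i) / of_nat (total_wt w) :: complex"
  have "pd j (euler_field w i m) z = ?c * (if i = j then 1 else 0)"
    using True
    by (intro pd_eqI[where g = "\<lambda>t. ?c * (z(j := t)) i"] DERIV_cmult fun_upd_coord_DERIV)
      (simp add: euler_field_def)
  with True show ?thesis by auto
next
  case False
  then have "pd j (euler_field w i m) z = 0"
    by (intro pd_eqI[where g = "\<lambda>t. 0"]) (simp_all add: euler_field_def)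
  with False show ?thesis by simp
qed

lemma not_distinctI:
  "p < length I \<Longrightarrow> q < length I \<Longrightarrow> p \<noteq> q \<Longrightarrow> I ! p = I ! q \<Longrightarrow> \<not> distinct I"
  by (auto simp: distinct_conv_nth)

lemma count_list_eq_card: "card {p. p < length I \<and> I ! p = i} = count_list I i"
  by (simp add: count_list_eq_length_filter length_filter_conv_card eq_commute)

lemma Omega0_DERIV:
  "((\<lambda>t. Omega0 w I (z(i := t))) has_field_derivative
     (if i \<in> {1..5} then of_nat (w i) * vol (i # I) else 0)) (at (z i))"
proof -
  have "((\<lambda>t. Omega0 w I (z(i := t))) has_field_derivative
     (\<Sum>\<rho>=1..5. of_nat (w \<rho>) * (if \<rho> = i then 1 else 0) * vol (\<rho> # I))) (at (z i))"
    unfolding Omega0_eq_contract_vol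
    by (intro DERIV_sum DERIV_cmult_right DERIV_cmult fun_upd_coord_DERIV)
  also have "(\<Sum>\<rho>=1..5. of_nat (w \<rho>) * (if \<rho> = i then 1 else 0) * vol (\<rho> # I))
      = (\<Sum>\<rho>=1..5. if \<rho> = i then of_nat (w i) * vol (i # I) else 0)"
    by (intro sum.cong) auto
  also have "\<dots> = (if i \<in> {1..5} then of_nat (w i) * vol (i # I) else 0)"
    by (rule sum.delta) simp
  finally show ?thesis .
qed

text \<open>
The flow of $z_i\partial_{z_i}$ scales $dz_i$, so each occurrence of $i$ among the slots contributes one
multiple of the component itself.
\<close>

lemma lie_euler_field:
  assumes i: "i \<in> {1..5}"
  shows "lie (euler_field w i) \<omega> I z = of_nat (w i) / of_nat (total_wt w)
     * (z i * pd i (\<omega> I) z + of_nat (count_list I i) * \<omega> I z)"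
proof -
  let ?c = "of_nat (w i) / of_nat (total_wt w) :: complex"
  have "(\<Sum>m=1..5. euler_field w i m z * pd m (\<omega> I) z) = (\<Sum>m=1..5. if m = i then ?c * z i * pd i (\<omega> I) z else 0)"
    by (intro sum.cong) (auto simp: euler_field_def)
  also have "\<dots> = ?c * z i * pd i (\<omega> I) z" using i by (subst sum.delta) auto
  finally have 1: "(\<Sum>m=1..5. euler_field w i m z * pd m (\<omega> I) z) = ?c * z i * pd i (\<omega> I) z" .
  have "(\<Sum>m=1..5. pd (I ! p) (euler_field w i m) z * \<omega> (I[p := m]) z)
      = (if I ! p = i then ?c * \<omega> I z else 0)" for p
  proof -
    have "(\<Sum>m=1..5. pd (I ! p) (euler_field w i m) z * \<omega> (I[p := m]) z)
      = (\<Sum>m=1..5. if m = i then (if I ! p = i then ?c * \<omega> (I[p := i]) z else 0) else 0)"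
      by (intro sum.cong) (auto simp: pd_euler_field)
    also have "\<dots> = (if I ! p = i then ?c * \<omega> (I[p := i]) z else 0)"
      using i by (subst sum.delta) auto
    finally show ?thesis by (auto simp: list_update_same_conv)
  qed
  then have "(\<Sum>p<length I. \<Sum>m=1..5. pd (I ! p) (euler_field w i m) z * \<omega> (I[p := m]) z)
      = (\<Sum>p<length I. if I ! p = i then ?c * \<omega> I z else 0)" by simp
  also have "\<dots> = of_nat (card {p \<in> {..<length I}. I ! p = i}) * (?c * \<omega> I z)"
    by (simp add: sum.If_cases Int_def)
  also have "card {p \<in> {..<length I}. I ! p = i} = count_list I i"
    using count_list_eq_card[of I i] by simp
  finally show ?thesis unfolding lie_def 1 by (simp add: algebra_simps)
qed

text \<open>
The scalar core of $\mathcal L_{z_i\partial_{z_i}}\Omega_0=\Omega_0$: in each summand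
$z_\rho\,\iota_{\partial_\rho}\mathrm{vol}$ the index $i$ occurs exactly once, either as the coefficient
$z_i$ or among the differentials.
\<close>

lemma count_Omega0:
  assumes "i \<in> {1..5}"
  shows "of_nat (count_list I i) * Omega0 w I z + of_nat (w i) * z i * vol (i # I) = Omega0 w I z"
proof -
  have count: "of_nat (count_list I i) * vol (\<rho> # I) = (if \<rho> = i then 0 else vol (\<rho> # I))" for \<rho>
  proof (cases "vol (\<rho> # I) = 0")
    case False
    then have "mset (\<rho> # I) = mset [1..<6]" by (rule vol_nonzeroD)
    then have "count (mset (\<rho> # I)) i = count (mset [1..<6]) i" by simp
    also have "\<dots> = 1" using assms by (subst distinct_count_atmost_1[THEN iffD1, rule_format]) auto
    finally show ?thesis by (auto simp: count_mset split: if_splits)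
  qed auto
  have "of_nat (count_list I i) * Omega0 w I z
      = (\<Sum>\<rho>=1..5. of_nat (w \<rho>) * z \<rho> * (of_nat (count_list I i) * vol (\<rho> # I)))"
    unfolding Omega0_eq_contract_vol by (simp add: sum_distrib_left mult_ac)
  also have "\<dots> + of_nat (w i) * z i * vol (i # I)
      = (\<Sum>\<rho>=1..5. of_nat (w \<rho>) * z \<rho> * (if \<rho> = i then 0 else vol (\<rho> # I)))
        + (\<Sum>\<rho>=1..5. if \<rho> = i then of_nat (w i) * z i * vol (i # I) else 0)"
    using assms by (subst sum.delta) (auto simp: count)
  also have "\<dots> = Omega0 w I z"
    unfolding Omega0_eq_contract_vol sum.distrib[symmetric] by (intro sum.cong) auto
  finally show ?thesis .
qed

text \<open>
Lie derivatives along the Euler fields preserve multiples of $\Omega_0$. The representation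
$\omega=g\,\Omega_0$ is only required near $z$, since it breaks down where the denominator vanishes.
\<close>

lemma lie_euler_field_Omega0:
  assumes i: "i \<in> {1..5}"
    and ev: "\<forall>\<^sub>F t in nhds (z i). \<omega> I (z(i := t)) = g (z(i := t)) * Omega0 w I (z(i := t))"
    and g: "((\<lambda>t. g (z(i := t))) has_field_derivative g') (at (z i))"
  shows "lie (euler_field w i) \<omega> I z
     = of_nat (w i) / of_nat (total_wt w) * (z i * g' + g z) * Omega0 w I z"
proof -
  have 0: "\<omega> I z = g z * Omega0 w I z" using eventually_nhds_x_imp_x[OF ev] by simp
  have "pd i (\<omega> I) z = g' * Omega0 w I z + of_nat (w i) * vol (i # I) * g z"
    using pd_eqI[OF ev DERIV_mult[OF g Omega0_DERIV[of w I z i]]] i by simp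
  then have "z i * pd i (\<omega> I) z + of_nat (count_list I i) * \<omega> I z
      = z i * g' * Omega0 w I z + g z *
         (of_nat (count_list I i) * Omega0 w I z + of_nat (w i) * z i * vol (i # I))"
    unfolding 0 by (simp add: algebra_simps)
  also have "\<dots> = (z i * g' + g z) * Omega0 w I z"
    unfolding count_Omega0[OF i] by (simp add: algebra_simps)
  finally show ?thesis unfolding lie_euler_field[OF i] by simp
qed

text \<open>
Both sides contain the derivatives of the components of $\omega$; those of $d\,\iota_X\omega$ cancel
against those of $\iota_X d\omega$ except for the term with the derivative in the direction $X$. What
remains are the derivatives of $X$, and there the alternation of $\omega$ is needed at the point $z$ only.
\<close>

lemma cartan_formula:
  assumes I: "I \<in> idx k"
    and alt: "\<And>p m. p < k \<Longrightarrow> m \<in> {1..5} \<Longrightarrow>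
       \<omega> (I[p := m]) z = (-1) ^ p * \<omega> (m # take p I @ drop (Suc p) I) z"
    and \<omega>: "\<And>J i. J \<in> idx k \<Longrightarrow> i \<in> {1..5} \<Longrightarrow>
       (\<lambda>t. \<omega> J (z(i := t))) field_differentiable at (z i)"
    and X: "\<And>m i. m \<in> {1..5} \<Longrightarrow> (\<lambda>t. X m (z(i := t))) field_differentiable at (z i)"
  shows "lie X \<omega> I z = ext_d (contract X \<omega>) I z + contract X (ext_d \<omega>) I z"
proof -
  let ?del = "\<lambda>p. take p I @ drop (Suc p) I"
  have len: "length I = k" and sub: "set I \<subseteq> {1..5}" using I by (auto simp: idx_def)
  have del: "m # ?del p \<in> idx k" if "p < k" "m \<in> {1..5}" for p m
    using that len sub set_take_subset[of p I] set_drop_subset[of "Suc p" I]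
    by (auto simp: idx_def)
  have mem: "I ! p \<in> {1..5}" if "p < k" for p using that len sub by (metis nth_mem subsetD)
  have d\<omega>: "((\<lambda>t. \<omega> J (z(i := t))) has_field_derivative pd i (\<omega> J) z) (at (z i))"
    if "J \<in> idx k" "i \<in> {1..5}" for J i
    using \<omega>[OF that] unfolding pd_def by (rule field_differentiable_derivI)
  have dX: "((\<lambda>t. X m (z(i := t))) has_field_derivative pd i (X m) z) (at (z i))"
    if "m \<in> {1..5}" for m i
    using X[OF that] unfolding pd_def by (rule field_differentiable_derivI)
  have pdc: "pd (I ! p) (contract X \<omega> (?del p)) z
      = (\<Sum>m=1..5. pd (I ! p) (X m) z * \<omega> (m # ?del p) z
           + X m z * pd (I ! p) (\<omega> (m # ?del p)) z)" if p: "p < k" for p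
  proof -
    have "((\<lambda>t. \<Sum>m=1..5. X m (z(I ! p := t)) * \<omega> (m # ?del p) (z(I ! p := t))) has_field_derivative
        (\<Sum>m=1..5. pd (I ! p) (X m) z * \<omega> (m # ?del p) z
           + pd (I ! p) (\<omega> (m # ?del p)) z * X m z)) (at (z (I ! p)))"
      using DERIV_mult[OF dX d\<omega>[OF del[OF p] mem[OF p]]] by (intro DERIV_sum) fastforce
    then have "pd (I ! p) (contract X \<omega> (?del p)) z = (\<Sum>m=1..5. pd (I ! p) (X m) z * \<omega> (m # ?del p) z
           + pd (I ! p) (\<omega> (m # ?del p)) z * X m z)"
      by (intro pd_eqI[where g = "\<lambda>t. \<Sum>m=1..5. X m (z(I ! p := t)) * \<omega> (m # ?del p) (z(I ! p := t))"])
        (simp_all add: contract_def)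
    then show ?thesis by (simp only: mult.commute)
  qed
  have d1: "ext_d (contract X \<omega>) I z = (\<Sum>p<k. (\<Sum>m=1..5. pd (I ! p) (X m) z * \<omega> (I[p := m]) z)
       + (\<Sum>m=1..5. X m z * ((-1) ^ p * pd (I ! p) (\<omega> (m # ?del p)) z)))"
    unfolding ext_d_def len
    by (intro sum.cong refl)
      (simp add: pdc alt sum.distrib sum_distrib_left algebra_simps)
  have d2: "ext_d \<omega> (m # I) z = pd m (\<omega> I) z
       - (\<Sum>p<k. (-1) ^ p * pd (I ! p) (\<omega> (m # ?del p)) z)" for m
    unfolding ext_d_def by (simp add: len sum.lessThan_Suc_shift sum_negf del: sum.lessThan_Suc)
  have "(\<Sum>p<k. \<Sum>m=1..5. X m z * ((-1) ^ p * pd (I ! p) (\<omega> (m # ?del p)) z))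
      = (\<Sum>m=1..5. X m z * (\<Sum>p<k. (-1) ^ p * pd (I ! p) (\<omega> (m # ?del p)) z))"
    by (subst sum.swap) (simp add: sum_distrib_left)
  then show ?thesis
    unfolding d1 contract_def d2 lie_def len
    by (simp only: sum.distrib sum_subtractf right_diff_distrib) simp
qed

text \<open>
The divergence formula $d(g\,\iota_E\mathrm{vol})=\mathrm{div}(gE)\,\mathrm{vol}$. It has to be checked on lists
with repeated indices as well: a repetition at two places leaves only two slots to be replaced, and their summands
are opposite because they differ by exchanging the two slots.
\<close>

lemma ext_d_Omega0:
  assumes I: "I \<in> idx 5"
    and ev: "\<And>J i. J \<in> idx 4 \<Longrightarrow> i \<in> {1..5} \<Longrightarrow>
      \<forall>\<^sub>F t in nhds (z i). \<omega> J (z(i := t)) = g (z(i := t)) * Omega0 w J (z(i := t))"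
    and g: "\<And>i. i \<in> {1..5} \<Longrightarrow> ((\<lambda>t. g (z(i := t))) has_field_derivative g' i) (at (z i))"
  shows "ext_d \<omega> I z = vol I * (\<Sum>i=1..5. of_nat (w i) * (z i * g' i + g z))"
proof -
  let ?del = "\<lambda>p. take p I @ drop (Suc p) I"
  have len: "length I = 5" and sub: "set I \<subseteq> {1..5}" using I by (auto simp: idx_def)
  have del: "?del p \<in> idx 4" if "p < 5" for p
    using that len sub set_take_subset[of p I] set_drop_subset[of "Suc p" I]
    by (auto simp: idx_def)
  have mem: "I ! p \<in> {1..5}" if "p < 5" for p using that len sub by (metis nth_mem subsetD)
  \<comment> \<open>the partial derivative in direction $i$ of $g\,w_\rho z_\rho$\<close>
  define h where "h i \<rho> = of_nat (w \<rho>) * (z \<rho> * g' i + (if \<rho> = i then g z else 0))" for i \<rho>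
  have pd_h: "(-1) ^ p * pd (I ! p) (\<omega> (?del p)) z
      = (\<Sum>\<rho>=1..5. h (I ! p) \<rho> * vol (I[p := \<rho>]))" if p: "p < 5" for p
  proof -
    let ?i = "I ! p"
    have "pd ?i (\<omega> (?del p)) z
        = g' ?i * Omega0 w (?del p) z + of_nat (w ?i) * vol (?i # ?del p) * g z"
      using pd_eqI[OF ev[OF del[OF p] mem[OF p]] DERIV_mult[OF g[OF mem[OF p]] Omega0_DERIV[of w "?del p" z ?i]]] mem[OF p]
      by simp
    also have "of_nat (w ?i) * vol (?i # ?del p) * g z
        = (\<Sum>\<rho>=1..5. if \<rho> = ?i then of_nat (w ?i) * vol (?i # ?del p) * g z else 0)"
      using mem[OF p] by (subst sum.delta) auto
    also have "g' ?i * Omega0 w (?del p) z + \<dots> = (\<Sum>\<rho>=1..5. h ?i \<rho> * vol (\<rho> # ?del p))"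
      unfolding Omega0_eq_contract_vol sum_distrib_left sum.distrib[symmetric]
      by (intro sum.cong) (auto simp: h_def algebra_simps)
    finally show ?thesis
      using alternating_replace[OF alternating_vol, of p I] p len
      by (simp add: sum_distrib_left mult_ac)
  qed
  have "ext_d \<omega> I z = (\<Sum>p<5. \<Sum>\<rho>=1..5. h (I ! p) \<rho> * vol (I[p := \<rho>]))"
    unfolding ext_d_def len by (intro sum.cong refl) (simp add: pd_h)
  also have "\<dots> = vol I * (\<Sum>i=1..5. h i i)"
  proof (cases "distinct I")
    case True
    have set: "set I = {1..5}"
      using True len sub by (intro card_subset_eq) (auto simp: distinct_card)
    have "vol (I[p := \<rho>]) = (if \<rho> = I ! p then vol I else 0)" if "p < 5" "\<rho> \<in> {1..5}" for p \<rho>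
    proof (cases "\<rho> = I ! p")
      case False
      have "\<rho> \<in> set I" using that set by simp
      then obtain q where q: "q < 5" "I ! q = \<rho>" using len by (auto simp: in_set_conv_nth)
      then have "q \<noteq> p" using False by auto
      then have "\<not> distinct (I[p := \<rho>])"
        using q that len by (intro not_distinctI[of p _ q]) simp_all
      then show ?thesis using False alternating_repeated[OF alternating_vol, of "I[p := \<rho>]"] by simp
    qed (use that len in \<open>simp\<close>)
    then have "(\<Sum>p<5. \<Sum>\<rho>=1..5. h (I ! p) \<rho> * vol (I[p := \<rho>]))
        = (\<Sum>p<5. \<Sum>\<rho>=1..5. if \<rho> = I ! p then h (I ! p) (I ! p) * vol I else 0)"
      by (intro sum.cong refl) auto
    also have "\<dots> = (\<Sum>p<5. h (I ! p) (I ! p) * vol I)"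
      using mem by (intro sum.cong refl) (auto simp: sum.delta)
    also have "\<dots> = (\<Sum>i=1..5. h i i * vol I)"
      by (intro sum.reindex_bij_betw[of "(!) I"] bij_betw_nth True) (auto simp: len set)
    finally show ?thesis by (simp add: sum_distrib_left mult.commute)
  next
    case False
    \<comment> \<open>Replacing an index other than the two equal ones leaves a repetition.\<close>
    obtain xs y ys zs where "I = xs @ [y] @ ys @ [y] @ zs"
      using not_distinct_decomp[OF False] by blast
    then have I': "I = xs @ y # ys @ y # zs" by simp
    let ?p = "length xs" and ?q = "Suc (length xs + length ys)"
    have pq: "?p < 5" "?q < 5" "?p \<noteq> ?q" "I ! ?p = y" "I ! ?q = y"
      using len by (auto simp: I' nth_append)
    have other: "vol (I[p := \<rho>]) = 0" if "p < 5" "p \<noteq> ?p" "p \<noteq> ?q" for p \<rho>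
    proof -
      have "\<not> distinct (I[p := \<rho>])"
        using pq that len by (intro not_distinctI[of ?p _ ?q]) auto
      then show ?thesis by (rule alternating_repeated[OF alternating_vol])
    qed
    have two: "vol (I[?p := \<rho>]) = - vol (I[?q := \<rho>])" for \<rho>
      using alternating_swap[OF alternating_vol, of xs \<rho> ys y zs]
      by (simp add: I' list_update_append)
    have "(\<Sum>p<5. \<Sum>\<rho>=1..5. h (I ! p) \<rho> * vol (I[p := \<rho>]))
        = (\<Sum>p\<in>{?p, ?q}. \<Sum>\<rho>=1..5. h (I ! p) \<rho> * vol (I[p := \<rho>]))"
      using pq other by (intro sum.mono_neutral_right) auto
    also have "\<dots> = 0" using pq by (simp add: two sum.distrib[symmetric])
    finally show ?thesis using alternating_repeated[OF alternating_vol False] by simp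
  qed
  finally show ?thesis by (simp add: h_def)
qed

text \<open>
Additivity of $d$ needs differentiability, as \<open>deriv\<close> is arbitrary elsewhere.
\<close>

lemma ext_d_sum:
  assumes "\<And>i p. i \<in> A \<Longrightarrow> p < length I \<Longrightarrow>
    (\<lambda>t. \<omega> i (take p I @ drop (Suc p) I) (z(I ! p := t))) field_differentiable at (z (I ! p))"
  shows "ext_d (\<lambda>J y. \<Sum>i\<in>A. \<omega> i J y) I z = (\<Sum>i\<in>A. ext_d (\<omega> i) I z)"
proof -
  let ?del = "\<lambda>p. take p I @ drop (Suc p) I"
  have "pd (I ! p) (\<lambda>y. \<Sum>i\<in>A. \<omega> i (?del p) y) z = (\<Sum>i\<in>A. pd (I ! p) (\<omega> i (?del p)) z)"
    if "p < length I" for p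
  proof -
    have "((\<lambda>t. \<Sum>i\<in>A. \<omega> i (?del p) (z(I ! p := t))) has_field_derivative
        (\<Sum>i\<in>A. pd (I ! p) (\<omega> i (?del p)) z)) (at (z (I ! p)))"
      unfolding pd_def by (intro DERIV_sum field_differentiable_derivI assms that)
    then show ?thesis by (rule pd_DERIV)
  qed
  then have "ext_d (\<lambda>J y. \<Sum>i\<in>A. \<omega> i J y) I z
      = (\<Sum>p<length I. \<Sum>i\<in>A. (-1) ^ p * pd (I ! p) (\<omega> i (?del p)) z)"
    unfolding ext_d_def by (simp add: sum_distrib_left)
  then show ?thesis unfolding ext_d_def by (subst (asm) sum.swap) simp
qed

lemma idx_del_insert:
  assumes "I \<in> idx k" "p < k" "m \<in> {1..5}"
  shows "m # take p I @ drop (Suc p) I \<in> idx k" "I[p := m] \<in> idx k" "I ! p \<in> {1..5}"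
proof -
  have len: "length I = k" and sub: "set I \<subseteq> {1..5}" using assms by (auto simp: idx_def)
  show "m # take p I @ drop (Suc p) I \<in> idx k"
    using assms len sub set_take_subset[of p I] set_drop_subset[of "Suc p" I] by (auto simp: idx_def)
  show "I[p := m] \<in> idx k"
    using assms len sub set_update_subset_insert[of I p m] by (auto simp: idx_def)
  show "I ! p \<in> {1..5}" using assms(2) len sub by (metis nth_mem subsetD)
qed

lemma compose_ops_map: "compose_ops (map g xs) F = foldr g xs F"
  unfolding compose_ops_def by (induction xs) simp_all


section \<open>Exponents of the monomials\<close>

lemma vector_4_nth:
  "(vector [x1, x2, x3, x4] :: 'a::zero ^ 4) $ 1 = x1"
  "(vector [x1, x2, x3, x4] :: 'a ^ 4) $ 2 = x2"
  "(vector [x1, x2, x3, x4] :: 'a ^ 4) $ 3 = x3"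
  "(vector [x1, x2, x3, x4] :: 'a ^ 4) $ 4 = x4"
  unfolding vector_def by simp_all

lemma total_wt_eq: "total_wt w = w 1 + w 2 + w 3 + w 4 + w 5"
  by (simp add: total_wt_def numeral_eq_Suc)

lemma sum_1_5: "(\<Sum>i=1..5. f i) = f 1 + f 2 + f 3 + f 4 + f (5::nat)"
  for f :: "nat \<Rightarrow> 'a::comm_monoid_add"
  by (simp add: numeral_eq_Suc add.assoc)

lemma one_to_five: "i \<in> {1..5::nat} \<longleftrightarrow> i = 1 \<or> i = 2 \<or> i = 3 \<or> i = 4 \<or> i = 5"
  by auto

lemma fermat_total_wt_pos: "fermat_weights w \<Longrightarrow> 0 < total_wt w"
  by (simp add: fermat_weights_def total_wt_eq)

text \<open>
This relation among the vertices makes the denominator weighted homogeneous of degree $d$.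
\<close>

lemma weighted_sum_vert:
  assumes "fermat_weights w"
  shows "(\<Sum>\<rho>=1..5. real (w \<rho>) *\<^sub>R vert w \<rho>) = 0"
proof -
  have "0 < w 1" "0 < w 2" "0 < w 3" "0 < w 4" "w 5 = 1"
    using assms by (auto simp: fermat_weights_def)
  then show ?thesis
    unfolding sum_1_5
    by (simp add: vec_eq_iff forall_4 vector_4_nth vert_def total_wt_eq field_simps)
qed

text \<open>
For the vertices of the dual polytope the denominator has the Fermat monomials $z_i^{d/w_i}$.
\<close>

lemma dual_vert_pairing:
  assumes "fermat_weights w" "i \<in> {1..5}" "\<rho> \<in> {1..5}"
  shows "dual_vert w i \<bullet> vert w \<rho> + 1 = (if i = \<rho> then real (total_wt w) / real (w \<rho>) else 0)"
proof -
  have "0 < w 1" "0 < w 2" "0 < w 3" "0 < w 4" "w 5 = 1"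
    using assms by (auto simp: fermat_weights_def)
  then show ?thesis
    using assms(2,3) unfolding one_to_five inner_vec_def sum_4 dual_vert_def vert_def Let_def
    by (elim disjE) (simp_all add: vector_4_nth total_wt_eq field_simps)
qed

text \<open>
A linear function is nonnegative on a polytope as soon as it is so at the vertices. Nonnegative
exponents make the denominator a polynomial, hence differentiable at points where some coordinate
vanishes.
\<close>

lemma dual_polytope_pairing_nonneg:
  assumes "fermat_weights w" "x \<in> dual_polytope w" "\<rho> \<in> {1..5}"
  shows "0 \<le> x \<bullet> vert w \<rho> + 1"
proof -
  have "dual_vert w ` {1..5} \<subseteq> {x. vert w \<rho> \<bullet> x \<ge> - 1}"
  proof (intro image_subsetI CollectI)
    fix i :: nat assume "i \<in> {1..5}"
    then have "dual_vert w i \<bullet> vert w \<rho> + 1 \<ge> 0"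
      using dual_vert_pairing[OF assms(1) _ assms(3)] by simp
    then show "vert w \<rho> \<bullet> dual_vert w i \<ge> - 1" by (simp add: inner_commute)
  qed
  then have "dual_polytope w \<subseteq> {x. vert w \<rho> \<bullet> x \<ge> - 1}"
    unfolding dual_polytope_def by (intro hull_minimal convex_halfspace_ge)
  then show ?thesis using assms(2) by (auto simp: inner_commute)
qed

lemma lattice_pairing_Ints:
  assumes "fermat_weights w" "\<forall>j. x $ j \<in> \<int>" "\<rho> \<in> {1..5}"
  shows "x \<bullet> vert w \<rho> + 1 \<in> \<int>"
proof -
  have "w \<rho> dvd total_wt w" using assms by (simp add: fermat_weights_def)
  then have "real (total_wt w) / real (w \<rho>) \<in> \<int>"
    by (metis Ints_of_nat real_of_nat_div)
  then have "vert w \<rho> $ j \<in> \<int>" for j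
    using exhaust_4[of j] by (auto simp: vert_def Let_def vector_4_nth)
  then show ?thesis
    using assms(2) unfolding inner_vec_def by (auto intro!: Ints_add Ints_sum Ints_mult)
qed

text \<open>
The exponent of $z_\rho$ in the $k$-th monomial, as a natural number, so that no powers with negative
exponents have to be considered.
\<close>

definition expo :: "(nat \<Rightarrow> nat) \<Rightarrow> (nat \<Rightarrow> real ^ 4) \<Rightarrow> nat \<Rightarrow> nat \<Rightarrow> nat" where
  "expo w v k \<rho> = nat \<lfloor>v k \<bullet> vert w \<rho> + 1\<rfloor>"

lemma expo_pairing:
  assumes "fermat_weights w" "enumerates_integral_points w N v" "k \<le> N" "\<rho> \<in> {1..5}"
  shows "of_int \<lfloor>v k \<bullet> vert w \<rho> + 1\<rfloor> = v k \<bullet> vert w \<rho> + 1"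
    and "int (expo w v k \<rho>) = \<lfloor>v k \<bullet> vert w \<rho> + 1\<rfloor>"
    and "real (expo w v k \<rho>) = v k \<bullet> vert w \<rho> + 1"
proof -
  have "v k \<in> {x \<in> dual_polytope w. \<forall>j. x $ j \<in> \<int>}"
    using assms(2,3) unfolding enumerates_integral_points_def bij_betw_def by auto
  then have x: "v k \<in> dual_polytope w" "\<forall>j. v k $ j \<in> \<int>" by auto
  show 1: "of_int \<lfloor>v k \<bullet> vert w \<rho> + 1\<rfloor> = v k \<bullet> vert w \<rho> + 1"
    using lattice_pairing_Ints[OF assms(1) x(2) assms(4)] by (rule of_int_floor)
  show 2: "int (expo w v k \<rho>) = \<lfloor>v k \<bullet> vert w \<rho> + 1\<rfloor>"
    using dual_polytope_pairing_nonneg[OF assms(1) x(1) assms(4)]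
    by (simp only: expo_def int_nat_eq zero_le_floor if_True)
  show "real (expo w v k \<rho>) = v k \<bullet> vert w \<rho> + 1"
    using 1 2 by (metis of_int_of_nat_eq)
qed

text \<open>
Homogeneity of the denominator.
\<close>

lemma expo_weighted_sum:
  assumes "fermat_weights w" "enumerates_integral_points w N v" "k \<le> N"
  shows "(\<Sum>\<rho>=1..5. w \<rho> * expo w v k \<rho>) = total_wt w"
proof -
  have "real (\<Sum>\<rho>=1..5. w \<rho> * expo w v k \<rho>) = (\<Sum>\<rho>=1..5. real (w \<rho>) * (v k \<bullet> vert w \<rho> + 1))"
    by (simp add: expo_pairing(3)[OF assms])
  also have "\<dots> = v k \<bullet> (\<Sum>\<rho>=1..5. real (w \<rho>) *\<^sub>R vert w \<rho>) + real (total_wt w)"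
    by (simp add: distrib_left sum.distrib inner_sum_right total_wt_def)
  finally show ?thesis
    by (simp only: weighted_sum_vert[OF assms(1)] inner_zero_right add_0 of_nat_eq_iff)
qed

lemma denom_expo:
  assumes "fermat_weights w" "enumerates_integral_points w N v"
  shows "denom w N v b y = (\<Sum>k\<le>N. b k * (\<Prod>\<rho>=1..5. y \<rho> ^ expo w v k \<rho>))"
  unfolding denom_def
  by (intro sum.cong prod.cong refl arg_cong2[where f = "(*)"])
    (simp only: expo_pairing(2)[OF assms, symmetric] power_int_of_nat atMost_iff)

text \<open>
A relation among the points $(1,v_k^*)$ is a relation among the exponent vectors, because exponents
are affine functions of the points.
\<close>

lemma relation_lattice_expo:
  assumes "fermat_weights w" "enumerates_integral_points w N v" "l \<in> relation_lattice N v"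
  shows "(\<Sum>k\<le>N. l k) = 0"
    and "\<rho> \<in> {1..5} \<Longrightarrow> (\<Sum>k\<le>N. l k * int (expo w v k \<rho>)) = 0"
proof -
  have *: "(\<Sum>k\<le>N. real_of_int (l k) *\<^sub>R (1 :: real, v k)) = 0"
    using assms(3) by (simp add: relation_lattice_def)
  have f: "(\<Sum>k\<le>N. real_of_int (l k)) = 0"
    using arg_cong[OF *, of fst] by (simp add: fst_sum)
  have s: "(\<Sum>k\<le>N. real_of_int (l k) *\<^sub>R v k) = 0"
    using arg_cong[OF *, of snd] by (simp add: snd_sum)
  show "(\<Sum>k\<le>N. l k) = 0" using f by (metis of_int_eq_0_iff of_int_sum)
  assume \<rho>: "\<rho> \<in> {1..5}"
  have "real_of_int (\<Sum>k\<le>N. l k * int (expo w v k \<rho>))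
      = (\<Sum>k\<le>N. real_of_int (l k) * (v k \<bullet> vert w \<rho> + 1))"
    using expo_pairing(3)[OF assms(1,2) _ \<rho>] by simp
  also have "\<dots> = (\<Sum>k\<le>N. real_of_int (l k) *\<^sub>R v k) \<bullet> vert w \<rho> + (\<Sum>k\<le>N. real_of_int (l k))"
    by (simp add: inner_sum_left distrib_left sum.distrib)
  finally show "(\<Sum>k\<le>N. l k * int (expo w v k \<rho>)) = 0" unfolding f s by (simp only: inner_zero_left add_0 of_int_eq_0_iff)
qed


section \<open>Logarithmic derivatives\<close>

text \<open>
\<open>log_deriv f x c\<close> says that $t\,\frac{d}{dt}$ multiplies $f$ by $c$ at the point $t=x$. Stating this
without division keeps it meaningful at $x=0$ and at zeros of $f$, and it turns products and powers
into sums and multiples of constants.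
\<close>

definition log_deriv :: "(complex \<Rightarrow> complex) \<Rightarrow> complex \<Rightarrow> complex \<Rightarrow> bool" where
  "log_deriv f x c \<longleftrightarrow> (\<exists>D. (f has_field_derivative D) (at x) \<and> x * D = c * f x)"

lemma log_derivI: "(f has_field_derivative D) (at x) \<Longrightarrow> x * D = c * f x \<Longrightarrow> log_deriv f x c"
  unfolding log_deriv_def by blast

lemma log_deriv_const: "log_deriv (\<lambda>_. k) x 0"
  by (rule log_derivI[OF DERIV_const]) simp

lemma log_deriv_coord: "log_deriv (\<lambda>t. (b(i := t)) j) (b i) (if j = i then 1 else 0)"
  unfolding log_deriv_def by (cases "j = i") (auto intro!: exI DERIV_ident DERIV_const)

lemma log_deriv_mult:
  assumes "log_deriv f x c" "log_deriv g x c'"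
  shows "log_deriv (\<lambda>t. f t * g t) x (c + c')"
proof -
  obtain D D' where D: "(f has_field_derivative D) (at x)" "x * D = c * f x"
    "(g has_field_derivative D') (at x)" "x * D' = c' * g x"
    using assms unfolding log_deriv_def by blast
  have "x * (D * g x + D' * f x) = (x * D) * g x + (x * D') * f x" by (simp add: algebra_simps)
  also have "\<dots> = (c + c') * (f x * g x)" unfolding D by (simp add: algebra_simps)
  finally show ?thesis by (rule log_derivI[OF DERIV_mult[OF D(1,3)]])
qed

lemma log_deriv_power:
  assumes "log_deriv f x c"
  shows "log_deriv (\<lambda>t. f t ^ n) x (of_nat n * c)"
proof (induction n)
  case (Suc n)
  from log_deriv_mult[OF assms Suc] show ?case by (simp add: algebra_simps)
qed (simp add: log_deriv_const)

lemma log_deriv_prod: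
  assumes "finite A" "\<And>i. i \<in> A \<Longrightarrow> log_deriv (f i) x (c i)"
  shows "log_deriv (\<lambda>t. \<Prod>i\<in>A. f i t) x (\<Sum>i\<in>A. c i)"
  using assms by (induction rule: finite_induct) (simp_all add: log_deriv_const log_deriv_mult)

text \<open>
A sum of eigenfunctions with different eigenvalues gets the weighted mean of the eigenvalues.
\<close>

lemma log_deriv_sum:
  assumes "\<And>i. i \<in> A \<Longrightarrow> log_deriv (f i) x (c i)" "(\<Sum>i\<in>A. f i x) \<noteq> 0"
  shows "log_deriv (\<lambda>t. \<Sum>i\<in>A. f i t) x ((\<Sum>i\<in>A. c i * f i x) / (\<Sum>i\<in>A. f i x))"
proof -
  obtain D where D: "\<And>i. i \<in> A \<Longrightarrow> (f i has_field_derivative D i) (at x)"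
    "\<And>i. i \<in> A \<Longrightarrow> x * D i = c i * f i x"
    using assms(1) unfolding log_deriv_def by metis
  have "x * (\<Sum>i\<in>A. D i) = (\<Sum>i\<in>A. c i * f i x)"
    using D(2) by (simp add: sum_distrib_left)
  then show ?thesis using assms(2) by (intro log_derivI[OF DERIV_sum[OF D(1)]]) simp_all
qed

lemma log_deriv_divide:
  assumes "log_deriv f x c" "log_deriv g x c'" "g x \<noteq> 0"
  shows "log_deriv (\<lambda>t. f t / g t) x (c - c')"
proof -
  obtain D D' where D: "(f has_field_derivative D) (at x)" "x * D = c * f x"
    "(g has_field_derivative D') (at x)" "x * D' = c' * g x"
    using assms unfolding log_deriv_def by blast
  have "x * ((D * g x - f x * D') / (g x * g x)) = ((x * D) * g x - f x * (x * D')) / (g x * g x)"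
    by (simp add: algebra_simps)
  also have "\<dots> = (c - c') * (f x / g x)" unfolding D using assms(3) by (simp add: field_simps)
  finally show ?thesis by (rule log_derivI[OF DERIV_divide[OF D(1,3) assms(3)]])
qed

lemma log_deriv_cong_ev:
  assumes "log_deriv f x c" "\<forall>\<^sub>F t in nhds x. f t = g t"
  shows "log_deriv g x c"
  using assms eventually_nhds_x_imp_x[OF assms(2)]
  unfolding log_deriv_def by (metis DERIV_cong_ev)

text \<open>
A branch of the logarithm is assumed to be continuous only. Near $x$ it differs from its value at $x$ by
less than $\pi$, so there it agrees with the principal logarithm of the quotient and is differentiable.
\<close>

lemma continuous_log_DERIV:
  fixes L r :: "complex \<Rightarrow> complex"
  assumes "isCont L x" "\<forall>\<^sub>F t in nhds x. exp (L t) = r t" "(r has_field_derivative r') (at x)"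
  shows "(L has_field_derivative r' / r x) (at x)"
proof -
  have rx: "r x = exp (L x)" using eventually_nhds_x_imp_x[OF assms(2)] by simp
  then have rx0: "r x \<noteq> 0" by simp
  have "((\<lambda>t. L t - L x) \<longlongrightarrow> L x - L x) (nhds x)"
    using assms(1) by (intro tendsto_intros) (simp_all add: continuous_at_imp_continuous_at_within isCont_def tendsto_at_iff_tendsto_nhds)
  then have "\<forall>\<^sub>F t in nhds x. dist (L t - L x) 0 < pi"
    by (intro tendstoD) simp_all
  with assms(2) have ev: "\<forall>\<^sub>F t in nhds x. L t = L x + Ln (r t / r x)"
  proof eventually_elim
    case (elim t)
    have "\<bar>Im (L t - L x)\<bar> < pi" using elim(2) abs_Im_le_cmod[of "L t - L x"] by simp
    then have "Ln (exp (L t - L x)) = L t - L x" by (intro Ln_exp) auto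
    then show ?case using elim(1) rx by (simp add: exp_diff)
  qed
  have "((\<lambda>t. L x + Ln (r t / r x)) has_field_derivative r' / r x) (at x)"
    using rx0 by (auto intro!: derivative_eq_intros assms(3))
  then show ?thesis using DERIV_cong_ev[OF refl ev refl] by blast
qed

lemma continuous_on_fun_upd: "continuous_on V (\<lambda>t. b(i := t))"
  for b :: "nat \<Rightarrow> complex"
proof (rule continuous_on_coordinatewise_then_product)
  show "continuous_on V (\<lambda>t. (b(i := t)) j)" for j
    by (cases "j = i") (simp_all add: continuous_on_id)
qed

lemma eventually_fun_upd_open:
  fixes U :: "(nat \<Rightarrow> complex) set"
  assumes "open U" "b \<in> U"
  shows "\<forall>\<^sub>F t in nhds (b i). b(i := t) \<in> U"
proof -
  have "continuous_on UNIV (\<lambda>t. b(i := t))" by (rule continuous_on_fun_upd)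
  then have "open ((\<lambda>t. b(i := t)) -` U)"
    using assms(1) by (intro open_vimage)
  from eventually_nhds_in_open[OF this, of "b i"] show ?thesis using assms(2) by simp
qed


section \<open>Commuting operators on a span of functions\<close>

text \<open>
Functions are generated by a family indexed by exponent vectors, of which only the entries up to
\<open>N\<close> matter. The generators may be linearly dependent, so the operators below act on functions and
not on formal combinations of generators.
\<close>

locale generated_functions =
  fixes \<Gamma> :: "(nat \<Rightarrow> nat) \<Rightarrow> 'p \<Rightarrow> complex" and N :: nat
begin

inductive_set lin_span :: "('p \<Rightarrow> complex) set" where
  gen: "\<Gamma> m \<in> lin_span"
| add: "f \<in> lin_span \<Longrightarrow> g \<in> lin_span \<Longrightarrow> (\<lambda>p. f p + g p) \<in> lin_span"
| scale: "f \<in> lin_span \<Longrightarrow> (\<lambda>p. c * f p) \<in> lin_span"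

text \<open>
The action of $\kappa+\sum_k\alpha_k\,T_k\partial_{T_k}$ on the functions $T^m\partial_T^m F$ of independent
variables $T_k$. Linearity is demanded on the span only, since the intended operators involve
derivatives.
\<close>

definition euler_op ::
    "(('p \<Rightarrow> complex) \<Rightarrow> 'p \<Rightarrow> complex) \<Rightarrow> (nat \<Rightarrow> complex) \<Rightarrow> complex \<Rightarrow> bool" where
  "euler_op T \<alpha> \<kappa> \<longleftrightarrow>
     (\<forall>f\<in>lin_span. \<forall>g\<in>lin_span. T (\<lambda>p. f p + g p) = (\<lambda>p. T f p + T g p))
   \<and> (\<forall>f\<in>lin_span. \<forall>c. T (\<lambda>p. c * f p) = (\<lambda>p. c * T f p))
   \<and> (\<forall>m. T (\<Gamma> m) = (\<lambda>p. (\<kappa> + (\<Sum>k\<le>N. \<alpha> k * of_nat (m k))) * \<Gamma> m p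
            + (\<Sum>k\<le>N. \<alpha> k * \<Gamma> (m(k := Suc (m k))) p)))"

definition is_euler_op where "is_euler_op T \<longleftrightarrow> (\<exists>\<alpha> \<kappa>. euler_op T \<alpha> \<kappa>)"

lemma is_euler_opI: "euler_op T \<alpha> \<kappa> \<Longrightarrow> is_euler_op T"
  unfolding is_euler_op_def by blast

lemma euler_op_add:
  "is_euler_op T \<Longrightarrow> f \<in> lin_span \<Longrightarrow> g \<in> lin_span \<Longrightarrow> T (\<lambda>p. f p + g p) = (\<lambda>p. T f p + T g p)"
  unfolding is_euler_op_def euler_op_def by blast

lemma euler_op_scale:
  "is_euler_op T \<Longrightarrow> f \<in> lin_span \<Longrightarrow> T (\<lambda>p. c * f p) = (\<lambda>p. c * T f p)"
  unfolding is_euler_op_def euler_op_def by blast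

lemma euler_op_gen:
  "euler_op T \<alpha> \<kappa> \<Longrightarrow> T (\<Gamma> m) = (\<lambda>p. (\<kappa> + (\<Sum>k\<le>N. \<alpha> k * of_nat (m k))) * \<Gamma> m p
            + (\<Sum>k\<le>N. \<alpha> k * \<Gamma> (m(k := Suc (m k))) p))"
  unfolding euler_op_def by blast

lemma sum_delta_mult:
  "i \<le> N \<Longrightarrow> (\<Sum>k\<le>N. (if k = i then 1 else 0) * F k) = (F i :: complex)"
  by (simp add: if_distrib[of "\<lambda>c. c * _"] cong: if_cong)

lemma zero_in_lin_span: "(\<lambda>p. 0) \<in> lin_span"
  using lin_span.scale[OF lin_span.gen, of 0] by simp

lemma sum_in_lin_span: "(\<And>i. i \<in> A \<Longrightarrow> f i \<in> lin_span) \<Longrightarrow> (\<lambda>p. \<Sum>i\<in>A. f i p) \<in> lin_span"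
  by (induction A rule: infinite_finite_induct) (auto intro: zero_in_lin_span lin_span.add)

lemma euler_op_zero: "is_euler_op T \<Longrightarrow> T (\<lambda>p. 0) = (\<lambda>p. 0)"
  using euler_op_scale[OF _ lin_span.gen, of T 0] by simp

lemma euler_op_sum:
  assumes "is_euler_op T" "\<And>i. i \<in> A \<Longrightarrow> f i \<in> lin_span"
  shows "T (\<lambda>p. \<Sum>i\<in>A. f i p) = (\<lambda>p. \<Sum>i\<in>A. T (f i) p)"
  using assms(2)
proof (induction A rule: infinite_finite_induct)
  case (insert x A)
  then have "T (\<lambda>p. f x p + (\<Sum>i\<in>A. f i p)) = (\<lambda>p. T (f x) p + T (\<lambda>p. \<Sum>i\<in>A. f i p) p)"
    by (intro euler_op_add assms(1) sum_in_lin_span) auto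
  with insert show ?case by simp
qed (simp_all add: euler_op_zero[OF assms(1)])

lemma euler_op_lin_span:
  assumes "is_euler_op T" "f \<in> lin_span"
  shows "T f \<in> lin_span"
  using assms(2)
proof induction
  case (gen m)
  obtain \<alpha> \<kappa> where "euler_op T \<alpha> \<kappa>" using assms(1) unfolding is_euler_op_def by blast
  from euler_op_gen[OF this] show ?case by (auto intro!: lin_span.add lin_span.scale sum_in_lin_span lin_span.gen)
qed (simp_all add: euler_op_add euler_op_scale assms(1) lin_span.add lin_span.scale)

text \<open>
On a generator, both orders give the same expression because the coefficients for raising two
exponents are symmetric; linearity extends this to the span.
\<close>

lemma euler_op_commute:
  assumes T: "is_euler_op T" and T': "is_euler_op T'" and f: "f \<in> lin_span"
  shows "T (T' f) = T' (T f)"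
  using f
proof induction
  case (gen m)
  obtain \<alpha> \<kappa> where e: "euler_op T \<alpha> \<kappa>" using T unfolding is_euler_op_def by blast
  obtain \<alpha>' \<kappa>' where e': "euler_op T' \<alpha>' \<kappa>'" using T' unfolding is_euler_op_def by blast
  define s where "s \<alpha> \<kappa> = \<kappa> + (\<Sum>k\<le>N. \<alpha> k * of_nat (m k))" for \<alpha> :: "nat \<Rightarrow> complex" and \<kappa>
  define u where "u k = m(k := Suc (m k))" for k
  \<comment> \<open>Every part of this expression is symmetric in the two operators, up to exchanging the indices of
    the double sum. It is stated for arbitrary operators so that it applies to both orders.\<close>
  have comp: "T (T' (\<Gamma> m)) p = s \<alpha>' \<kappa>' * (s \<alpha> \<kappa> * \<Gamma> m p)
        + (\<Sum>k\<le>N. s \<alpha>' \<kappa>' * \<alpha> k * \<Gamma> (u k) p + s \<alpha> \<kappa> * \<alpha>' k * \<Gamma> (u k) p + \<alpha>' k * \<alpha> k * \<Gamma> (u k) p)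
        + (\<Sum>k\<le>N. \<Sum>j\<le>N. \<alpha>' k * \<alpha> j * \<Gamma> ((u k)(j := Suc (u k j))) p)"
    if e: "euler_op T \<alpha> \<kappa>" and e': "euler_op T' \<alpha>' \<kappa>'" for T T' \<alpha> \<alpha>' \<kappa> \<kappa>' p
  proof -
    note T = is_euler_opI[OF e]
    have shift: "(\<Sum>j\<le>N. \<alpha> j * of_nat (u k j)) = (\<Sum>j\<le>N. \<alpha> j * of_nat (m j)) + \<alpha> k"
      if "k \<le> N" for k
    proof -
      have "(\<Sum>j\<le>N. \<alpha> j * of_nat (u k j))
          = (\<Sum>j\<le>N. \<alpha> j * of_nat (m j) + (if j = k then \<alpha> k else 0))"
        by (intro sum.cong) (auto simp: u_def algebra_simps)
      then show ?thesis using that by (simp add: sum.distrib)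
    qed
    have "T (T' (\<Gamma> m)) = (\<lambda>p. s \<alpha>' \<kappa>' * T (\<Gamma> m) p + (\<Sum>k\<le>N. \<alpha>' k * T (\<Gamma> (u k)) p))"
      unfolding euler_op_gen[OF e'] s_def[symmetric] u_def[symmetric]
      by (simp add: euler_op_add[OF T] euler_op_scale[OF T] euler_op_sum[OF T] lin_span.intros sum_in_lin_span)
    moreover have "(\<Sum>k\<le>N. \<alpha>' k * T (\<Gamma> (u k)) p)
        = (\<Sum>k\<le>N. s \<alpha> \<kappa> * \<alpha>' k * \<Gamma> (u k) p + \<alpha>' k * \<alpha> k * \<Gamma> (u k) p
             + (\<Sum>j\<le>N. \<alpha>' k * \<alpha> j * \<Gamma> ((u k)(j := Suc (u k j))) p))"
      by (intro sum.cong refl)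
        (simp add: euler_op_gen[OF e] shift s_def algebra_simps sum_distrib_left)
    moreover have "T (\<Gamma> m) p = s \<alpha> \<kappa> * \<Gamma> m p + (\<Sum>k\<le>N. \<alpha> k * \<Gamma> (u k) p)"
      by (simp add: euler_op_gen[OF e] s_def u_def)
    ultimately show ?thesis
      by (simp add: sum.distrib distrib_left sum_distrib_left mult.assoc)
  qed
  have uu: "(u k)(j := Suc (u k j)) = (u j)(k := Suc (u j k))" for j k
    by (auto simp: u_def fun_eq_iff)
  have "(\<Sum>k\<le>N. \<Sum>j\<le>N. \<alpha>' k * \<alpha> j * \<Gamma> ((u k)(j := Suc (u k j))) p)
      = (\<Sum>k\<le>N. \<Sum>j\<le>N. \<alpha> k * \<alpha>' j * \<Gamma> ((u k)(j := Suc (u k j))) p)" for p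
    by (subst sum.swap) (simp add: uu mult.commute)
  then show ?case
    by (intro ext, simp only: comp[OF e e'] comp[OF e' e]) (simp add: algebra_simps)
next
  case (add f g)
  then show ?case using T T' by (simp add: euler_op_add euler_op_lin_span)
next
  case (scale f c)
  then show ?case using T T' by (simp add: euler_op_scale euler_op_lin_span)
qed

lemma foldr_euler_lin_span:
  "(\<And>x. x \<in> set xs \<Longrightarrow> is_euler_op (h x)) \<Longrightarrow> f \<in> lin_span \<Longrightarrow> foldr h xs f \<in> lin_span"
  by (induction xs) (simp_all add: euler_op_lin_span)

text \<open>
Commutation allows any factor of a product of operators to be moved to the front.
\<close>

lemma foldr_euler_pull:
  assumes "\<And>x. x \<in> set xs \<Longrightarrow> is_euler_op (h x)" "f \<in> lin_span" "x \<in> set xs"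
  shows "foldr h xs f = h x (foldr h (remove1 x xs) f)"
  using assms
proof (induction xs)
  case (Cons y ys)
  show ?case
  proof (cases "x = y")
    case False
    then have "foldr h (y # ys) f = h y (h x (foldr h (remove1 x ys) f))"
      using Cons by simp
    also have "\<dots> = h x (h y (foldr h (remove1 x ys) f))"
      using Cons.prems set_remove1_subset[of x ys] by (intro euler_op_commute foldr_euler_lin_span) auto
    finally show ?thesis using False by simp
  qed simp
qed simp

text \<open>
Expanding a product of binomials \<open>\<theta> x + M x\<close>: one term for each set of factors that contribute
their second summand. The order of the factors is kept.
\<close>

lemma foldr_euler_expand:
  assumes "distinct xs" "\<And>x. x \<in> set xs \<Longrightarrow> is_euler_op (\<theta> x)"
    "\<And>x. x \<in> set xs \<Longrightarrow> x \<in> L \<Longrightarrow> is_euler_op (M x)" "f \<in> lin_span"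
  shows "foldr (\<lambda>x. if x \<in> L then (\<lambda>f p. \<theta> x f p + M x f p) else \<theta> x) xs f
    = (\<lambda>p. \<Sum>A\<in>Pow (L \<inter> set xs). foldr (\<lambda>x. if x \<in> A then M x else \<theta> x) xs f p)"
  using assms(1-3)
proof (induction xs)
  case (Cons x xs)
  let ?h = "\<lambda>A x. if x \<in> A then M x else \<theta> x"
  let ?P = "Pow (L \<inter> set xs)"
  define F where "F A = foldr (?h A) xs f" for A
  have FS: "F A \<in> lin_span" if "A \<in> ?P" for A
    unfolding F_def using that Cons.prems by (intro foldr_euler_lin_span assms(4)) auto
  have x: "is_euler_op (\<theta> x)" using Cons.prems by simp
  have IH: "foldr (\<lambda>x. if x \<in> L then (\<lambda>f p. \<theta> x f p + M x f p) else \<theta> x) xs f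
      = (\<lambda>p. \<Sum>A\<in>?P. F A p)"
    unfolding F_def using Cons.prems by (intro Cons.IH) auto
  have out: "foldr (?h A) (x # xs) f = \<theta> x (F A)" if "A \<in> ?P" for A
    using that Cons.prems(1) by (auto simp: F_def)
  have "foldr (?h (insert x A)) xs f = F A" for A
    unfolding F_def using Cons.prems(1) by (intro foldr_cong) auto
  then have "in": "foldr (?h (insert x A)) (x # xs) f = M x (F A)" for A
    by simp
  have \<theta>: "\<theta> x (\<lambda>p. \<Sum>A\<in>?P. F A p) p = (\<Sum>A\<in>?P. foldr (?h A) (x # xs) f p)" for p
    by (subst euler_op_sum[OF x, of ?P F, OF FS], assumption, rule sum.cong, rule refl)
      (simp only: out)
  show ?case
  proof (cases "x \<in> L")
    case False
    then have "L \<inter> set (x # xs) = L \<inter> set xs" by auto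
    then show ?thesis using False
      by (intro ext) (simp only: foldr_Cons o_apply if_False IH \<theta>)
  next
    case True
    then have Mx: "is_euler_op (M x)" using Cons.prems by simp
    have inj: "inj_on (insert x) ?P" using Cons.prems(1) by (auto simp: inj_on_def)
    have M: "M x (\<lambda>p. \<Sum>A\<in>?P. F A p) p = (\<Sum>A\<in>insert x ` ?P. foldr (?h A) (x # xs) f p)" for p
      by (subst euler_op_sum[OF Mx, of ?P F, OF FS], assumption)
        (simp only: sum.reindex[OF inj] o_def "in")
    have "L \<inter> set (x # xs) = insert x (L \<inter> set xs)" using True by auto
    then have P: "Pow (L \<inter> set (x # xs)) = ?P \<union> insert x ` ?P" by (simp only: Pow_insert)
    have "?P \<inter> insert x ` ?P = {}" using Cons.prems(1) by auto
    then have "(\<Sum>A\<in>Pow (L \<inter> set (x # xs)). foldr (?h A) (x # xs) f p)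
        = \<theta> x (\<lambda>p. \<Sum>A\<in>?P. F A p) p + M x (\<lambda>p. \<Sum>A\<in>?P. F A p) p" for p
      unfolding P \<theta> M by (intro sum.union_disjoint) auto
    then show ?thesis using True
      by (intro ext) (simp only: foldr_Cons o_apply if_True IH)
  qed
qed simp

text \<open>
The factors of one index raise its exponent step by step: the factor with $j=s+m_i$ meets a
generator on which its diagonal coefficient is zero. The outermost factor of the list has the
smallest $j$ but has to act first, which is harmless since the factors commute.
\<close>

lemma foldr_raise_block:
  assumes H: "\<And>j. euler_op (H (i, j)) (\<lambda>k. if k = i then 1 else 0) (of_nat s - of_nat j)"
    and i: "i \<le> N" and m: "m i = 0"
  shows "foldr H (map (Pair i) [s..<s + n]) (\<Gamma> m) = \<Gamma> (m(i := n))"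
proof (induction n)
  case 0
  then show ?case using m by (simp add: fun_upd_idem)
next
  case (Suc n)
  let ?xs = "map (Pair i) [s..<s + n]"
  have "map (Pair i) [s..<s + Suc n] = ?xs @ [(i, s + n)]" by simp
  moreover have "remove1 (i, s + n) (?xs @ [(i, s + n)]) = ?xs"
    by (subst remove1_append) auto
  ultimately have "foldr H (map (Pair i) [s..<s + Suc n]) (\<Gamma> m) = H (i, s + n) (foldr H ?xs (\<Gamma> m))"
    using foldr_euler_pull[of "?xs @ [(i, s + n)]" H "\<Gamma> m" "(i, s + n)"] is_euler_opI[OF H] lin_span.gen
    by auto
  also have "\<dots> = \<Gamma> (m(i := Suc n))"
    unfolding Suc euler_op_gen[OF H] sum_delta_mult[OF i] by simp
  finally show ?case .
qed

lemma foldr_raise_blocks: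
  assumes H: "\<And>i j. i \<le> N \<Longrightarrow> euler_op (H (i, j)) (\<lambda>k. if k = i then 1 else 0) (of_nat (s i) - of_nat j)"
    and "distinct is" "set is \<subseteq> {..N}"
  shows "foldr H (concat (map (\<lambda>i. map (Pair i) [s i..<s i + n i]) is)) (\<Gamma> (\<lambda>_. 0))
     = \<Gamma> (\<lambda>k. if k \<in> set is then n k else 0)"
  using assms(2,3)
proof (induction "is")
  case (Cons i "is")
  have "(\<lambda>k. if k \<in> set is then n k else 0)(i := n i) = (\<lambda>k. if k \<in> set (i # is) then n k else 0)"
    by auto
  moreover have "foldr H (map (Pair i) [s i..<s i + n i]) (\<Gamma> (\<lambda>k. if k \<in> set is then n k else 0))
      = \<Gamma> ((\<lambda>k. if k \<in> set is then n k else 0)(i := n i))"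
    using Cons.prems by (intro foldr_raise_block H) auto
  ultimately show ?case using Cons by simp
qed simp

end


section \<open>The rescaled family as a function of parameters and coordinates\<close>

locale fermat_family =
  fixes w :: "nat \<Rightarrow> nat" and N :: nat and v :: "nat \<Rightarrow> real ^ 4"
    and U :: "point set" and lg :: "nat \<Rightarrow> point \<Rightarrow> complex"
  assumes fermat: "fermat_weights w"
    and points: "enumerates_integral_points w N v"
    and open_U: "open U"
    and nonzero: "\<forall>b\<in>U. \<forall>i\<le>N. b i \<noteq> 0"
    and branches: "log_branches U lg"
begin

definition wt :: "nat \<Rightarrow> complex" where
  "wt i = of_nat (w i) / of_nat (total_wt w)"

definition lam :: "point \<Rightarrow> nat \<Rightarrow> complex" where
  "lam b \<rho> = exp (wt \<rho> * lg \<rho> b)"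

text \<open>
The summands $T_k$ of the denominator after rescaling. Points of parameter and coordinate space
are paired, so that the operators in $a$ and in $z$ act on the same kind of functions.
\<close>

definition mon :: "nat \<Rightarrow> point \<times> point \<Rightarrow> complex" where
  "mon k p = fst p k * (\<Prod>\<rho>=1..5. (lam (fst p) \<rho> * snd p \<rho>) ^ expo w v k \<rho>)"

definition Q :: "point \<times> point \<Rightarrow> complex" where
  "Q p = (\<Sum>k\<le>N. mon k p)"

text \<open>
The locus where $\tilde\Pi$ is defined. It is open along every coordinate line, which is what the
partial derivatives need.
\<close>

definition regular :: "(point \<times> point) set" where
  "regular = {p. fst p \<in> U \<and> Q p \<noteq> 0}"

definition pref :: "point \<Rightarrow> complex" where
  "pref b = b 0 * (\<Prod>\<rho>=1..5. lam b \<rho>)"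

definition tdeg :: "(nat \<Rightarrow> nat) \<Rightarrow> nat" where
  "tdeg m = (\<Sum>k\<le>N. m k)"

text \<open>
This is $a_0\prod_\rho\lambda_\rho\cdot T^m\partial_T^m(1/Q)$ with $Q=\sum_kT_k$; for $m=0$ it is the factor of
$\Omega_0$ in $\tilde\Pi$. Setting it to zero off the regular locus makes the identities below equalities of
functions.
\<close>

definition pole :: "(nat \<Rightarrow> nat) \<Rightarrow> point \<times> point \<Rightarrow> complex" where
  "pole m p = (if p \<in> regular
     then pref (fst p) * ((-1) ^ tdeg m * fact (tdeg m)) * (\<Prod>k\<le>N. mon k p ^ m k) / Q p ^ Suc (tdeg m)
     else 0)"

sublocale generated_functions pole N .

lemma N5: "5 \<le> N" using points by (simp add: enumerates_integral_points_def)

lemma total_wt_nz: "of_nat (total_wt w) \<noteq> (0::complex)"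
  using fermat_total_wt_pos[OF fermat] by simp

lemma sum_wt: "(\<Sum>\<rho>=1..5. wt \<rho>) = 1"
proof -
  have "(\<Sum>\<rho>=1..5. wt \<rho>) = of_nat (total_wt w) / of_nat (total_wt w)"
    unfolding wt_def sum_divide_distrib[symmetric] total_wt_def by simp
  then show ?thesis using total_wt_nz by simp
qed

lemma sum_expo_wt:
  assumes "k \<le> N"
  shows "(\<Sum>\<rho>=1..5. of_nat (expo w v k \<rho>) * wt \<rho>) = 1"
proof -
  have "(\<Sum>\<rho>=1..5. of_nat (expo w v k \<rho>) * wt \<rho>)
      = of_nat (\<Sum>\<rho>=1..5. w \<rho> * expo w v k \<rho>) / of_nat (total_wt w)"
    by (simp add: wt_def sum_divide_distrib mult.commute)
  then show ?thesis unfolding expo_weighted_sum[OF fermat points assms] using total_wt_nz by simp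
qed

lemma denom_eq_Q: "denom w N v b (phi1 w lg b z) = Q (b, z)"
  unfolding denom_expo[OF fermat points] Q_def mon_def phi1_def lam_def wt_def by simp

lemma tdeg_upd: "k \<le> N \<Longrightarrow> tdeg (m(k := Suc (m k))) = Suc (tdeg m)"
proof -
  assume "k \<le> N"
  have "tdeg (m(k := Suc (m k))) = (\<Sum>i\<le>N. m i + (if i = k then 1 else 0))"
    unfolding tdeg_def by (intro sum.cong) auto
  then show ?thesis using \<open>k \<le> N\<close> by (simp add: sum.distrib tdeg_def)
qed

lemma pole_raise:
  assumes "k \<le> N" "p \<in> regular"
  shows "pole (m(k := Suc (m k))) p = - of_nat (Suc (tdeg m)) * (mon k p / Q p) * pole m p"
proof -
  have "(\<Prod>i\<le>N. mon i p ^ (m(k := Suc (m k))) i) = (\<Prod>i\<le>N. mon i p ^ m i * (if i = k then mon k p else 1))"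
    by (intro prod.cong) auto
  also have "\<dots> = (\<Prod>i\<le>N. mon i p ^ m i) * mon k p"
    using assms(1) by (simp add: prod.distrib)
  finally show ?thesis
    using assms(2) unfolding pole_def tdeg_upd[OF assms(1)] by (simp add: field_simps)
qed

text \<open>
Euler's relation for $\partial_T^m(1/Q)$, which is homogeneous of degree $-1-|m|$ in $T$.
\<close>

lemma sum_pole_raise:
  "(\<Sum>k\<le>N. pole (m(k := Suc (m k))) p) = - of_nat (Suc (tdeg m)) * pole m p"
proof (cases "p \<in> regular")
  case True
  have "(\<Sum>k\<le>N. pole (m(k := Suc (m k))) p)
      = - of_nat (Suc (tdeg m)) * ((\<Sum>k\<le>N. mon k p) / Q p) * pole m p"
    by (simp add: pole_raise[OF _ True] sum_distrib_left sum_distrib_right sum_divide_distrib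
        sum_negf del: of_nat_Suc)
  then show ?thesis using True by (simp add: regular_def Q_def)
qed (simp add: pole_def)

text \<open>
The chain rule along an arbitrary curve in parameters and coordinates: if
$t\,\frac{d}{dt}$ multiplies each $T_k$ by $\alpha_k$ and the prefactor by $\kappa$, then it acts on the functions
\<open>pole m\<close> as the corresponding Euler operator in $T$. Both kinds of operators, in the parameters and in
the coordinates, are special cases.
\<close>

lemma pole_curve:
  assumes x: "c x \<in> regular" and U: "\<forall>\<^sub>F t in nhds x. fst (c t) \<in> U"
    and T: "\<And>k. k \<le> N \<Longrightarrow> log_deriv (\<lambda>t. mon k (c t)) x (\<alpha> k)"
    and pref: "log_deriv (\<lambda>t. pref (fst (c t))) x \<kappa>"
  shows "\<forall>\<^sub>F t in nhds x. c t \<in> regular"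
    and "\<exists>D. ((\<lambda>t. pole m (c t)) has_field_derivative D) (at x) \<and>
      x * D = (\<kappa> + (\<Sum>k\<le>N. \<alpha> k * of_nat (m k))) * pole m (c x)
        + (\<Sum>k\<le>N. \<alpha> k * pole (m(k := Suc (m k))) (c x))"
proof -
  have Qx: "Q (c x) \<noteq> 0" using x by (simp add: regular_def)
  have Q: "log_deriv (\<lambda>t. Q (c t)) x ((\<Sum>k\<le>N. \<alpha> k * mon k (c x)) / Q (c x))"
    unfolding Q_def using T Qx by (intro log_deriv_sum) (auto simp: Q_def)
  then have "isCont (\<lambda>t. Q (c t)) x"
    unfolding log_deriv_def using DERIV_isCont by blast
  then have "\<forall>\<^sub>F t in nhds x. Q (c t) \<noteq> 0"
    using Qx tendsto_at_iff_tendsto_nhds[of "\<lambda>t. Q (c t)" x]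
    by (intro tendsto_imp_eventually_ne[of _ "Q (c x)"]) (simp_all add: isCont_def)
  with U show ev: "\<forall>\<^sub>F t in nhds x. c t \<in> regular"
    by eventually_elim (simp add: regular_def)
  let ?C = "\<kappa> + 0 + (\<Sum>k\<le>N. of_nat (m k) * \<alpha> k)
     - of_nat (Suc (tdeg m)) * ((\<Sum>k\<le>N. \<alpha> k * mon k (c x)) / Q (c x))"
  have "log_deriv (\<lambda>t. pref (fst (c t)) * ((-1) ^ tdeg m * fact (tdeg m))
      * (\<Prod>k\<le>N. mon k (c t) ^ m k) / Q (c t) ^ Suc (tdeg m)) x ?C"
    using Qx T
    by (intro log_deriv_divide log_deriv_mult log_deriv_prod log_deriv_power log_deriv_const pref Q) auto
  then have "log_deriv (\<lambda>t. pole m (c t)) x ?C"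
    by (rule log_deriv_cong_ev) (use ev in \<open>eventually_elim, simp add: pole_def\<close>)
  then obtain D where D: "((\<lambda>t. pole m (c t)) has_field_derivative D) (at x)"
    "x * D = ?C * pole m (c x)" unfolding log_deriv_def by blast
  have raise: "(\<Sum>k\<le>N. \<alpha> k * pole (m(k := Suc (m k))) (c x))
      = - of_nat (Suc (tdeg m)) * ((\<Sum>k\<le>N. \<alpha> k * mon k (c x)) / Q (c x)) * pole m (c x)"
    by (simp add: pole_raise[OF _ x] sum_distrib_left sum_distrib_right sum_divide_distrib
        sum_negf mult_ac del: of_nat_Suc)
  have split: "(\<kappa> + 0 + A - n * R) * G = (\<kappa> + A) * G + - n * R * G" for A n R G :: complex
    by (simp add: algebra_simps)
  have comm: "(\<Sum>k\<le>N. of_nat (m k) * \<alpha> k) = (\<Sum>k\<le>N. \<alpha> k * of_nat (m k))"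
    by (simp add: mult.commute)
  have "x * D = (\<kappa> + (\<Sum>k\<le>N. \<alpha> k * of_nat (m k))) * pole m (c x)
        + (\<Sum>k\<le>N. \<alpha> k * pole (m(k := Suc (m k))) (c x))"
    unfolding raise using D(2) by (simp only: split comm)
  with D(1) show "\<exists>D. ((\<lambda>t. pole m (c t)) has_field_derivative D) (at x) \<and>
      x * D = (\<kappa> + (\<Sum>k\<le>N. \<alpha> k * of_nat (m k))) * pole m (c x)
        + (\<Sum>k\<le>N. \<alpha> k * pole (m(k := Suc (m k))) (c x))" by blast
qed

text \<open>
The logarithmic derivative of $a_0/a_\rho$ with respect to $a_i$.
\<close>

definition lam_wt :: "nat \<Rightarrow> nat \<Rightarrow> complex" where
  "lam_wt i \<rho> = (if i = 0 then 1 else if i = \<rho> then -1 else 0)"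

text \<open>
The factor by which $a_i\partial_{a_i}$ multiplies $T_k$; the sum accounts for the dependence of the rescaled
coordinates on $a_i$.
\<close>

definition \<alpha>b :: "nat \<Rightarrow> nat \<Rightarrow> complex" where
  "\<alpha>b i k = (if k = i then 1 else 0) + (\<Sum>\<rho>=1..5. of_nat (expo w v k \<rho>) * (wt \<rho> * lam_wt i \<rho>))"

definition \<kappa>b :: "nat \<Rightarrow> complex" where
  "\<kappa>b i = (if i = 0 then 1 else 0) + (\<Sum>\<rho>=1..5. wt \<rho> * lam_wt i \<rho>)"

text \<open>
Here the branches of the logarithm enter: only the exponential of \<open>lg \<rho>\<close> is known, and
it determines the derivative.
\<close>

lemma lam_log_deriv:
  assumes b: "b \<in> U" and i: "i \<le> N" and \<rho>: "\<rho> \<in> {1..5}"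
  shows "log_deriv (\<lambda>t. lam (b(i := t)) \<rho>) (b i) (wt \<rho> * lam_wt i \<rho>)"
proof -
  have nz: "b i \<noteq> 0" "b 0 \<noteq> 0" "b \<rho> \<noteq> 0" using nonzero b i \<rho> N5 by auto
  \<comment> \<open>first for the quotient $a_0/a_\rho$ itself, whose logarithm is then controlled by continuity\<close>
  have "log_deriv (\<lambda>t. (b(i := t)) 0 / (b(i := t)) \<rho>) (b i)
      ((if 0 = i then 1 else 0) - (if \<rho> = i then 1 else 0))"
    using nz by (intro log_deriv_divide log_deriv_coord) simp_all
  then have "log_deriv (\<lambda>t. (b(i := t)) 0 / (b(i := t)) \<rho>) (b i) (lam_wt i \<rho>)"
    using \<rho> by (auto simp: lam_wt_def split: if_splits)
  then obtain r' where r': "((\<lambda>t. (b(i := t)) 0 / (b(i := t)) \<rho>) has_field_derivative r') (at (b i))"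
    "b i * r' = lam_wt i \<rho> * (b 0 / b \<rho>)"
    unfolding log_deriv_def by auto
  have evU: "\<forall>\<^sub>F t in nhds (b i). b(i := t) \<in> U" by (rule eventually_fun_upd_open[OF open_U b])
  have "isCont (\<lambda>t. lg \<rho> (b(i := t))) (b i)"
  proof -
    obtain V where V: "open V" "b i \<in> V" "\<And>t. t \<in> V \<Longrightarrow> b(i := t) \<in> U"
      using evU unfolding eventually_nhds by blast
    have "continuous_on V (\<lambda>t. b(i := t))" by (rule continuous_on_fun_upd)
    then have "continuous_on V (\<lambda>t. lg \<rho> (b(i := t)))"
      using branches \<rho> V(3) unfolding log_branches_def
      by (intro continuous_on_compose2[of U "lg \<rho>" V "\<lambda>t. b(i := t)"]) auto
    then show ?thesis using V(1,2) by (simp add: continuous_on_eq_continuous_at)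
  qed
  moreover have "\<forall>\<^sub>F t in nhds (b i). exp (lg \<rho> (b(i := t))) = (b(i := t)) 0 / (b(i := t)) \<rho>"
    using evU by eventually_elim (use branches \<rho> in \<open>auto simp: log_branches_def\<close>)
  ultimately have L: "((\<lambda>t. lg \<rho> (b(i := t))) has_field_derivative r' / (b 0 / b \<rho>)) (at (b i))"
    using continuous_log_DERIV[OF _ _ r'(1)] by simp
  have L': "b i * (r' / (b 0 / b \<rho>)) = lam_wt i \<rho>" using r'(2) nz by (simp add: field_simps)
  have "((\<lambda>t. lam (b(i := t)) \<rho>) has_field_derivative lam b \<rho> * (wt \<rho> * (r' / (b 0 / b \<rho>)))) (at (b i))"
    unfolding lam_def using DERIV_fun_exp[OF DERIV_cmult[OF L, of "wt \<rho>"]] by simp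
  moreover have "b i * (lam b \<rho> * (wt \<rho> * (r' / (b 0 / b \<rho>)))) = wt \<rho> * lam_wt i \<rho> * lam b \<rho>"
    unfolding L'[symmetric] by (simp only: mult_ac)
  ultimately show ?thesis by (intro log_derivI) (assumption, simp only: fun_upd_triv)
qed

lemma mon_log_deriv_b:
  assumes "b \<in> U" "i \<le> N"
  shows "log_deriv (\<lambda>t. mon k (b(i := t), z)) (b i) (\<alpha>b i k)"
proof -
  have "log_deriv (\<lambda>t. mon k (b(i := t), z)) (b i) ((if k = i then 1 else 0)
     + (\<Sum>\<rho>=1..5. of_nat (expo w v k \<rho>) * (wt \<rho> * lam_wt i \<rho> + 0)))"
    unfolding mon_def fst_conv snd_conv
    by (intro log_deriv_mult log_deriv_prod log_deriv_power log_deriv_coord log_deriv_const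
        lam_log_deriv assms) auto
  then show ?thesis by (simp add: \<alpha>b_def)
qed

lemma pref_log_deriv_b:
  assumes "b \<in> U" "i \<le> N"
  shows "log_deriv (\<lambda>t. pref (b(i := t))) (b i) (\<kappa>b i)"
proof -
  have "log_deriv (\<lambda>t. pref (b(i := t))) (b i) ((if 0 = i then 1 else 0)
     + (\<Sum>\<rho>=1..5. wt \<rho> * lam_wt i \<rho>))"
    unfolding pref_def
    by (intro log_deriv_mult log_deriv_prod log_deriv_coord lam_log_deriv assms) auto
  moreover have "(if 0 = i then 1 else 0) = (if i = 0 then 1 else (0 :: complex))" by auto
  ultimately show ?thesis unfolding \<kappa>b_def by (simp only:)
qed

lemma mon_log_deriv_z:
  assumes "i \<in> {1..5}"
  shows "log_deriv (\<lambda>t. mon k (b, z(i := t))) (z i) (of_nat (expo w v k i))"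
proof -
  have "log_deriv (\<lambda>t. mon k (b, z(i := t))) (z i) (0
     + (\<Sum>\<rho>=1..5. of_nat (expo w v k \<rho>) * (0 + (if \<rho> = i then 1 else 0))))"
    unfolding mon_def fst_conv snd_conv
    by (intro log_deriv_mult log_deriv_prod log_deriv_power log_deriv_coord log_deriv_const) auto
  then show ?thesis using assms by (simp add: if_distrib[of "\<lambda>c. _ * c"] cong: if_cong)
qed

lemma pole_curve_b:
  assumes "(b, z) \<in> regular" "i \<le> N"
  shows "\<forall>\<^sub>F t in nhds (b i). (b(i := t), z) \<in> regular"
    and "\<exists>D. ((\<lambda>t. pole m (b(i := t), z)) has_field_derivative D) (at (b i)) \<and>
      b i * D = (\<kappa>b i + (\<Sum>k\<le>N. \<alpha>b i k * of_nat (m k))) * pole m (b, z)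
        + (\<Sum>k\<le>N. \<alpha>b i k * pole (m(k := Suc (m k))) (b, z))"
proof -
  have b: "b \<in> U" using assms by (simp add: regular_def)
  note c = pole_curve[of "\<lambda>t. (b(i := t), z)" "b i" "\<alpha>b i" "\<kappa>b i"]
  show "\<forall>\<^sub>F t in nhds (b i). (b(i := t), z) \<in> regular"
    by (rule c(1)) (use assms b eventually_fun_upd_open[OF open_U b] in
        \<open>simp_all add: mon_log_deriv_b pref_log_deriv_b\<close>)
  have "\<exists>D. ((\<lambda>t. pole m (b(i := t), z)) has_field_derivative D) (at (b i)) \<and>
      b i * D = (\<kappa>b i + (\<Sum>k\<le>N. \<alpha>b i k * of_nat (m k))) * pole m (b(i := b i), z)
        + (\<Sum>k\<le>N. \<alpha>b i k * pole (m(k := Suc (m k))) (b(i := b i), z))"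
    by (rule c(2)) (use assms b eventually_fun_upd_open[OF open_U b] in
        \<open>simp_all add: mon_log_deriv_b pref_log_deriv_b\<close>)
  then show "\<exists>D. ((\<lambda>t. pole m (b(i := t), z)) has_field_derivative D) (at (b i)) \<and>
      b i * D = (\<kappa>b i + (\<Sum>k\<le>N. \<alpha>b i k * of_nat (m k))) * pole m (b, z)
        + (\<Sum>k\<le>N. \<alpha>b i k * pole (m(k := Suc (m k))) (b, z))" by (simp only: fun_upd_triv)
qed

lemma pole_curve_z:
  assumes "(b, z) \<in> regular" "i \<in> {1..5}"
  shows "\<forall>\<^sub>F t in nhds (z i). (b, z(i := t)) \<in> regular"
    and "\<exists>D. ((\<lambda>t. pole m (b, z(i := t))) has_field_derivative D) (at (z i)) \<and>
      z i * D = (0 + (\<Sum>k\<le>N. of_nat (expo w v k i) * of_nat (m k))) * pole m (b, z)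
        + (\<Sum>k\<le>N. of_nat (expo w v k i) * pole (m(k := Suc (m k))) (b, z))"
proof -
  have b: "b \<in> U" using assms by (simp add: regular_def)
  note c = pole_curve[of "\<lambda>t. (b, z(i := t))" "z i" "\<lambda>k. of_nat (expo w v k i)" 0]
  show "\<forall>\<^sub>F t in nhds (z i). (b, z(i := t)) \<in> regular"
    by (rule c(1)) (use assms b in \<open>simp_all add: mon_log_deriv_z log_deriv_const\<close>)
  have "\<exists>D. ((\<lambda>t. pole m (b, z(i := t))) has_field_derivative D) (at (z i)) \<and>
      z i * D = (0 + (\<Sum>k\<le>N. of_nat (expo w v k i) * of_nat (m k))) * pole m (b, z(i := z i))
        + (\<Sum>k\<le>N. of_nat (expo w v k i) * pole (m(k := Suc (m k))) (b, z(i := z i)))"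
    by (rule c(2)) (use assms b in \<open>simp_all add: mon_log_deriv_z log_deriv_const\<close>)
  then show "\<exists>D. ((\<lambda>t. pole m (b, z(i := t))) has_field_derivative D) (at (z i)) \<and>
      z i * D = (0 + (\<Sum>k\<le>N. of_nat (expo w v k i) * of_nat (m k))) * pole m (b, z)
        + (\<Sum>k\<le>N. of_nat (expo w v k i) * pole (m(k := Suc (m k))) (b, z))"
    by (simp only: fun_upd_triv)
qed

lemma lin_span_DERIV_b:
  assumes "f \<in> lin_span" "(b, z) \<in> regular" "i \<le> N"
  shows "((\<lambda>t. f (b(i := t), z)) has_field_derivative pd i (\<lambda>b. f (b, z)) b) (at (b i))"
proof -
  have "(\<lambda>t. f (b(i := t), z)) field_differentiable at (b i)"
    using assms(1)
  proof induction
    case (gen m)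
    from pole_curve_b(2)[OF assms(2,3), of m] show ?case unfolding field_differentiable_def by blast
  qed (simp_all add: field_differentiable_add field_differentiable_mult field_differentiable_const)
  then show ?thesis unfolding pd_def by (rule field_differentiable_derivI)
qed

lemma lin_span_DERIV_z:
  assumes "f \<in> lin_span" "(b, z) \<in> regular" "i \<in> {1..5}"
  shows "((\<lambda>t. f (b, z(i := t))) has_field_derivative pd i (\<lambda>z. f (b, z)) z) (at (z i))"
proof -
  have "(\<lambda>t. f (b, z(i := t))) field_differentiable at (z i)"
    using assms(1)
  proof induction
    case (gen m)
    from pole_curve_z(2)[OF assms(2,3), of m] show ?case unfolding field_differentiable_def by blast
  qed (simp_all add: field_differentiable_add field_differentiable_mult field_differentiable_const)
  then show ?thesis unfolding pd_def by (rule field_differentiable_derivI)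
qed

text \<open>
What \<open>theta_shift\<close> does to the factor of $\Omega_0$, cut off outside the regular locus like \<open>pole\<close>.
\<close>

definition theta_fun :: "nat \<times> nat \<Rightarrow> (point \<times> point \<Rightarrow> complex) \<Rightarrow> point \<times> point \<Rightarrow> complex" where
  "theta_fun = (\<lambda>(i, j) f p. if p \<in> regular
     then fst p i * pd i (\<lambda>b. f (b, snd p)) (fst p) - of_nat j * f p else 0)"

text \<open>
What the Lie derivative along $\frac{w_i}{d}z_i\partial_{z_i}$ does to the factor $f$ in $f\,\Omega_0$. The extra
summand $f$ is the contribution of $\Omega_0$ itself.
\<close>

definition lie_fun :: "nat \<Rightarrow> (point \<times> point \<Rightarrow> complex) \<Rightarrow> point \<times> point \<Rightarrow> complex" where
  "lie_fun i f p = (if p \<in> regular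
     then wt i * (snd p i * pd i (\<lambda>z. f (fst p, z)) (snd p) + f p) else 0)"

lemma euler_op_theta_fun:
  assumes i: "i \<le> N"
  shows "euler_op (theta_fun (i, j)) (\<alpha>b i) (\<kappa>b i - of_nat j)"
  unfolding euler_op_def
proof (intro conjI ballI allI)
  fix f g and c :: complex assume f: "f \<in> lin_span"
  have "theta_fun (i, j) (\<lambda>p. c * f p) p = c * theta_fun (i, j) f p" for p
  proof (cases "p \<in> regular")
    case True
    then have d: "(fst p, snd p) \<in> regular" by simp
    show ?thesis using True pd_DERIV[OF DERIV_cmult[OF lin_span_DERIV_b[OF f d i], of c]]
      by (simp add: theta_fun_def algebra_simps)
  qed (simp add: theta_fun_def)
  then show "theta_fun (i, j) (\<lambda>p. c * f p) = (\<lambda>p. c * theta_fun (i, j) f p)" by blast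
  assume g: "g \<in> lin_span"
  have "theta_fun (i, j) (\<lambda>p. f p + g p) p = theta_fun (i, j) f p + theta_fun (i, j) g p" for p
  proof (cases "p \<in> regular")
    case True
    then have d: "(fst p, snd p) \<in> regular" by simp
    show ?thesis using True pd_DERIV[OF DERIV_add[OF lin_span_DERIV_b[OF f d i] lin_span_DERIV_b[OF g d i]]]
      by (simp add: theta_fun_def algebra_simps)
  qed (simp add: theta_fun_def)
  then show "theta_fun (i, j) (\<lambda>p. f p + g p) = (\<lambda>p. theta_fun (i, j) f p + theta_fun (i, j) g p)" by blast
next
  fix m
  have "theta_fun (i, j) (pole m) (b, z) = (\<kappa>b i - of_nat j + (\<Sum>k\<le>N. \<alpha>b i k * of_nat (m k))) * pole m (b, z)
      + (\<Sum>k\<le>N. \<alpha>b i k * pole (m(k := Suc (m k))) (b, z))" for b z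
  proof (cases "(b, z) \<in> regular")
    case True
    obtain D where D: "((\<lambda>t. pole m (b(i := t), z)) has_field_derivative D) (at (b i))"
      "b i * D = (\<kappa>b i + (\<Sum>k\<le>N. \<alpha>b i k * of_nat (m k))) * pole m (b, z)
        + (\<Sum>k\<le>N. \<alpha>b i k * pole (m(k := Suc (m k))) (b, z))"
      using pole_curve_b(2)[OF True i] by blast
    show ?thesis using True D(2) pd_DERIV[OF D(1)] by (simp add: theta_fun_def algebra_simps)
  qed (simp add: theta_fun_def pole_def)
  then show "theta_fun (i, j) (pole m) = (\<lambda>p. (\<kappa>b i - of_nat j + (\<Sum>k\<le>N. \<alpha>b i k * of_nat (m k))) * pole m p
      + (\<Sum>k\<le>N. \<alpha>b i k * pole (m(k := Suc (m k))) p))" by auto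
qed

text \<open>
Here $\kappa=\frac{w_i}{d}$ comes from $\Omega_0$, as \<open>pole\<close> has no other dependence on $z$ than through
the $T_k$.
\<close>

lemma euler_op_lie_fun:
  assumes i: "i \<in> {1..5}"
  shows "euler_op (lie_fun i) (\<lambda>k. wt i * of_nat (expo w v k i)) (wt i)"
  unfolding euler_op_def
proof (intro conjI ballI allI)
  fix f g and c :: complex assume f: "f \<in> lin_span"
  have "lie_fun i (\<lambda>p. c * f p) p = c * lie_fun i f p" for p
  proof (cases "p \<in> regular")
    case True
    then have d: "(fst p, snd p) \<in> regular" by simp
    show ?thesis using True pd_DERIV[OF DERIV_cmult[OF lin_span_DERIV_z[OF f d i], of c]]
      by (simp add: lie_fun_def algebra_simps)
  qed (simp add: lie_fun_def)
  then show "lie_fun i (\<lambda>p. c * f p) = (\<lambda>p. c * lie_fun i f p)" by blast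
  assume g: "g \<in> lin_span"
  have "lie_fun i (\<lambda>p. f p + g p) p = lie_fun i f p + lie_fun i g p" for p
  proof (cases "p \<in> regular")
    case True
    then have d: "(fst p, snd p) \<in> regular" by simp
    show ?thesis using True pd_DERIV[OF DERIV_add[OF lin_span_DERIV_z[OF f d i] lin_span_DERIV_z[OF g d i]]]
      by (simp add: lie_fun_def algebra_simps)
  qed (simp add: lie_fun_def)
  then show "lie_fun i (\<lambda>p. f p + g p) = (\<lambda>p. lie_fun i f p + lie_fun i g p)" by blast
next
  fix m
  have "lie_fun i (pole m) (b, z) = (wt i + (\<Sum>k\<le>N. wt i * of_nat (expo w v k i) * of_nat (m k))) * pole m (b, z)
      + (\<Sum>k\<le>N. wt i * of_nat (expo w v k i) * pole (m(k := Suc (m k))) (b, z))" for b z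
  proof (cases "(b, z) \<in> regular")
    case True
    obtain D where D: "((\<lambda>t. pole m (b, z(i := t))) has_field_derivative D) (at (z i))"
      "z i * D = (0 + (\<Sum>k\<le>N. of_nat (expo w v k i) * of_nat (m k))) * pole m (b, z)
        + (\<Sum>k\<le>N. of_nat (expo w v k i) * pole (m(k := Suc (m k))) (b, z))"
      using pole_curve_z(2)[OF True i] by blast
    have "lie_fun i (pole m) (b, z) = wt i * (z i * D + pole m (b, z))"
      using True pd_DERIV[OF D(1)] by (simp add: lie_fun_def)
    then show ?thesis unfolding D(2)
      by (simp add: distrib_left distrib_right sum_distrib_left sum_distrib_right mult.assoc)
  qed (simp add: lie_fun_def pole_def)
  then show "lie_fun i (pole m) = (\<lambda>p. (wt i + (\<Sum>k\<le>N. wt i * of_nat (expo w v k i) * of_nat (m k))) * pole m p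
      + (\<Sum>k\<le>N. wt i * of_nat (expo w v k i) * pole (m(k := Suc (m k))) p))" by auto
qed


section \<open>The Lie-corrected operators and the lattice relation\<close>

lemma eventually_regular_b:
  "(b, z) \<in> regular \<Longrightarrow> i \<le> N \<Longrightarrow> \<forall>\<^sub>F t in nhds (b i). (b(i := t), z) \<in> regular"
  by (rule pole_curve_b(1))

lemma eventually_regular_z:
  "(b, z) \<in> regular \<Longrightarrow> i \<in> {1..5} \<Longrightarrow> \<forall>\<^sub>F t in nhds (z i). (b, z(i := t)) \<in> regular"
  by (rule pole_curve_z(1))

text \<open>
The factors of $\hat D_l$. The one for $i=0$ carries no correction, since that would be the sum of all five
Lie derivatives, which vanishes on the forms in question.
\<close>

definition theta_hat where
  "theta_hat = (\<lambda>x. if x \<in> {x. fst x \<in> {1..5}}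
     then (\<lambda>f p. theta_fun x f p + lie_fun (fst x) f p) else theta_fun x)"

lemma sum_wt_lam_wt:
  assumes "i \<le> N"
  shows "(\<Sum>\<rho>=1..5. F \<rho> * (wt \<rho> * lam_wt i \<rho>))
    = (if i = 0 then \<Sum>\<rho>=1..5. F \<rho> * wt \<rho> else if i \<in> {1..5} then - F i * wt i else 0)"
proof (cases "i = 0")
  case False
  have "(\<Sum>\<rho>=1..5. F \<rho> * (wt \<rho> * lam_wt i \<rho>)) = (\<Sum>\<rho>=1..5. if \<rho> = i then - F i * wt i else 0)"
    using False by (intro sum.cong) (auto simp: lam_wt_def)
  also have "\<dots> = (if i \<in> {1..5} then - F i * wt i else 0)"
    by (rule sum.delta) simp
  finally show ?thesis using False by simp
qed (simp add: lam_wt_def)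

lemma \<alpha>b_eq:
  assumes "i \<le> N" "k \<le> N"
  shows "\<alpha>b i k = (if k = i then 1 else 0)
    + (if i = 0 then 1 else if i \<in> {1..5} then - (wt i * of_nat (expo w v k i)) else 0)"
  unfolding \<alpha>b_def sum_wt_lam_wt[OF assms(1)] sum_expo_wt[OF assms(2)] by simp

lemma \<kappa>b_eq:
  assumes "i \<le> N"
  shows "\<kappa>b i = (if i = 0 then 2 else if i \<in> {1..5} then - wt i else 0)"
  using sum_wt_lam_wt[OF assms, of "\<lambda>_. 1"] unfolding \<kappa>b_def by (simp add: sum_wt del: One_nat_def)

lemma euler_op_cong:
  assumes "euler_op D \<alpha> \<kappa>" "\<And>k. k \<le> N \<Longrightarrow> \<alpha> k = \<alpha>' k" "\<kappa> = \<kappa>'"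
  shows "euler_op D \<alpha>' \<kappa>'"
  using assms unfolding euler_op_def by simp

lemma euler_op_plus:
  assumes "euler_op D \<alpha> \<kappa>" "euler_op D' \<alpha>' \<kappa>'"
  shows "euler_op (\<lambda>f p. D f p + D' f p) (\<lambda>k. \<alpha> k + \<alpha>' k) (\<kappa> + \<kappa>')"
  using assms unfolding euler_op_def
  by (simp add: fun_eq_iff algebra_simps sum.distrib)

text \<open>
For $1\le i\le5$ the Lie derivative cancels exactly the contribution of $\lambda_i$ to
$a_i\partial_{a_i}$. For $i=0$ the rescaling contributes one for every $T_k$ and one for the prefactor, and by
Euler's relation these contributions cancel; the factor $a_0$ remains and accounts for
the shift by one, which is why the factors for $i=0$ start with $j=1$.
\<close>

lemma euler_op_theta_hat:
  assumes i: "i \<le> N"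
  shows "euler_op (theta_hat (i, j)) (\<lambda>k. if k = i then 1 else 0)
     (of_nat (if i = 0 then 1 else 0) - of_nat j)"
proof (cases "i = 0")
  case True
  have th: "euler_op (theta_fun (i, j)) (\<alpha>b i) (\<kappa>b i - of_nat j)" by (rule euler_op_theta_fun[OF i])
  have "theta_fun (i, j) (pole m) p = (1 - of_nat j + (\<Sum>k\<le>N. (if k = i then 1 else 0) * of_nat (m k))) * pole m p
      + (\<Sum>k\<le>N. (if k = i then 1 else 0) * pole (m(k := Suc (m k))) p)" for m p
  proof -
    have 1: "(\<Sum>k\<le>N. \<alpha>b i k * of_nat (m k)) = of_nat (m i) + of_nat (tdeg m)"
      using sum_delta_mult[OF i, of "\<lambda>k. of_nat (m k)"] i True
      by (simp add: \<alpha>b_eq distrib_right sum.distrib tdeg_def)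
    have 2: "(\<Sum>k\<le>N. \<alpha>b i k * pole (m(k := Suc (m k))) p)
        = pole (m(i := Suc (m i))) p - of_nat (Suc (tdeg m)) * pole m p"
      using sum_delta_mult[OF i, of "\<lambda>k. pole (m(k := Suc (m k))) p"] i True sum_pole_raise[of m p]
      by (simp add: \<alpha>b_eq distrib_right left_diff_distrib sum.distrib)
    show ?thesis
      unfolding euler_op_gen[OF th] 1 2 sum_delta_mult[OF i]
      using True by (simp add: \<kappa>b_eq algebra_simps)
  qed
  moreover have "theta_hat (i, j) = theta_fun (i, j)" using True by (simp add: theta_hat_def)
  ultimately show ?thesis using th True unfolding euler_op_def by auto
next
  case False
  show ?thesis
  proof (cases "i \<in> {1..5}")
    case True
    then have "theta_hat (i, j) = (\<lambda>f p. theta_fun (i, j) f p + lie_fun i f p)"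
      by (simp add: theta_hat_def)
    then show ?thesis
      using False True i
      by (auto intro!: euler_op_cong[OF euler_op_plus[OF euler_op_theta_fun[OF i] euler_op_lie_fun[OF True]]]
          simp: \<alpha>b_eq \<kappa>b_eq)
  next
    case F: False
    then have "theta_hat (i, j) = theta_fun (i, j)" unfolding theta_hat_def by auto
    then show ?thesis
      using False F i by (auto intro!: euler_op_cong[OF euler_op_theta_fun[OF i]] simp: \<alpha>b_eq \<kappa>b_eq)
  qed
qed

definition pos_part :: "(nat \<Rightarrow> int) \<Rightarrow> nat \<Rightarrow> nat" where
  "pos_part l = (\<lambda>k. if k \<le> N then nat (l k) else 0)"

text \<open>
The index $0$ differs from the others only in the starting value of $j$.
\<close>

lemma factors_blocks:
  "factors N l = concat (map (\<lambda>i. map (Pair i)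
     [(if i = 0 then 1 else 0)..<(if i = 0 then 1 else 0) + nat (l i)]) [0..<Suc N])"
proof -
  let ?f = "\<lambda>i. map (Pair i) [(if i = 0 then 1 else 0)..<(if i = 0 then 1 else 0) + nat (l i)]"
  have "[0..<Suc N] = 0 # [1..<Suc N]" by (simp add: upt_conv_Cons del: upt_Suc)
  then have "concat (map ?f [0..<Suc N]) = ?f 0 @ concat (map ?f [1..<Suc N])"
    by (simp only: list.map concat.simps)
  also have "map ?f [1..<Suc N] = map (\<lambda>i. map (Pair i) [0..<nat (l i)]) [1..<Suc N]"
    by (intro map_cong refl) auto
  also have "?f 0 = map (Pair 0) [1..<Suc (nat (l 0))]" by simp
  finally show ?thesis unfolding factors_def by (rule sym)
qed

lemma fst_factors: "x \<in> set (factors N l) \<Longrightarrow> fst x \<le> N"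
  unfolding factors_blocks by (auto simp del: upt_Suc)

lemma distinct_factors: "distinct (factors N l)"
proof -
  have "distinct (concat (map (\<lambda>i. map (Pair i) [s i..<t i]) is))" if "distinct is"
    for s t :: "nat \<Rightarrow> nat" and "is" :: "nat list"
    using that by (induction "is") (auto simp: distinct_map inj_on_def)
  then show ?thesis unfolding factors_blocks by (simp del: upt_Suc)
qed

lemma foldr_raise_factors: "foldr theta_hat (factors N l) (pole (\<lambda>_. 0)) = pole (pos_part l)"
proof -
  have "foldr theta_hat (factors N l) (pole (\<lambda>_. 0))
      = pole (\<lambda>k. if k \<in> set [0..<Suc N] then nat (l k) else 0)"
    unfolding factors_blocks by (intro foldr_raise_blocks euler_op_theta_hat) (auto simp del: upt_Suc)
  also have "(\<lambda>k. if k \<in> set [0..<Suc N] then nat (l k) else 0) = pos_part l"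
    by (auto simp: pos_part_def simp del: upt_Suc)
  finally show ?thesis .
qed

text \<open>
Since $\sum_kl_k=0$, the vectors $l^+$ and $l^-$ have the same total degree, so constants and powers of
$Q$ agree. Since $l$ is a relation among the exponent vectors, the monomials in $y$ agree as well, and only
$\prod_ka_k^{l_k}$ is left. Working with $l^+$ and $l^-$ separately covers points where some $T_k$ vanishes.
\<close>

lemma pole_lattice:
  assumes l: "l \<in> relation_lattice N v"
  shows "pole (pos_part l) (b, z) = lmonom N l b * pole (pos_part (\<lambda>i. - l i)) (b, z)"
proof (cases "(b, z) \<in> regular")
  case True
  then have "b \<in> U" by (simp add: regular_def)
  then have nz: "b k \<noteq> 0" if "k \<le> N" for k using nonzero that by auto
  \<comment> \<open>$T_k$ without its explicit factor $a_k$; it may be zero, unlike $a_k$\<close>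
  define Y where "Y k = (\<Prod>\<rho>=1..5. (lam b \<rho> * z \<rho>) ^ expo w v k \<rho>)" for k
  let ?p = "pos_part l" and ?q = "pos_part (\<lambda>i. - l i)"
  have pq: "int (?p k) - int (?q k) = l k" if "k \<le> N" for k using that by (auto simp: pos_part_def)
  have "int (tdeg ?p) - int (tdeg ?q) = (\<Sum>k\<le>N. l k)"
    unfolding tdeg_def of_nat_sum sum_subtractf[symmetric] using pq by (intro sum.cong) auto
  then have degs: "tdeg ?p = tdeg ?q" by (simp add: relation_lattice_expo[OF fermat points l])
  have expo: "(\<Sum>k\<le>N. expo w v k \<rho> * ?p k) = (\<Sum>k\<le>N. expo w v k \<rho> * ?q k)" if \<rho>: "\<rho> \<in> {1..5}" for \<rho>
  proof -
    have "int (\<Sum>k\<le>N. expo w v k \<rho> * ?p k) - int (\<Sum>k\<le>N. expo w v k \<rho> * ?q k)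
        = (\<Sum>k\<le>N. l k * int (expo w v k \<rho>))"
      unfolding of_nat_sum sum_subtractf[symmetric] using pq
      by (intro sum.cong) (simp_all add: pq[symmetric] algebra_simps)
    then show ?thesis using relation_lattice_expo(2)[OF fermat points l \<rho>] by linarith
  qed
  have Y: "(\<Prod>k\<le>N. Y k ^ m k) = (\<Prod>\<rho>=1..5. (lam b \<rho> * z \<rho>) ^ (\<Sum>k\<le>N. expo w v k \<rho> * m k))" for m
    unfolding Y_def prod_power_distrib power_mult[symmetric]
    by (subst prod.swap) (simp add: power_sum)
  have YY: "(\<Prod>k\<le>N. Y k ^ ?p k) = (\<Prod>k\<le>N. Y k ^ ?q k)"
    unfolding Y using expo by (intro prod.cong) auto
  have "b k ^ ?p k = b k powi l k * b k ^ ?q k" if "k \<le> N" for k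
    using nz[OF that] pq[OF that]
    by (metis diff_add_cancel power_int_add power_int_of_nat)
  then have bb: "(\<Prod>k\<le>N. b k ^ ?p k) = lmonom N l b * (\<Prod>k\<le>N. b k ^ ?q k)"
    unfolding lmonom_def prod.distrib[symmetric] by (intro prod.cong) auto
  have T: "(\<Prod>k\<le>N. mon k (b, z) ^ m k) = (\<Prod>k\<le>N. b k ^ m k) * (\<Prod>k\<le>N. Y k ^ m k)" for m
    unfolding mon_def Y_def by (simp add: power_mult_distrib prod.distrib)
  show ?thesis using True unfolding pole_def T YY bb degs by simp
qed (simp add: pole_def)

text \<open>
Forms $f\,\Omega_0$ with $f$ in the span are invariant under the weighted scaling of the coordinates: all
$T_k$ have weighted degree $d$, $\Omega_0$ has weighted degree $d$ as well, and $T^m\partial_T^m(1/Q)$ has degree $-1$ in $T$.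
\<close>

lemma sum_lie_fun_eq_0:
  assumes "f \<in> lin_span"
  shows "(\<Sum>i=1..5. lie_fun i f p) = 0"
  using assms
proof induction
  case (gen m)
  have "(\<Sum>i=1..5. lie_fun i (pole m) p) = (\<Sum>i=1..5. wt i * pole m p
      + (\<Sum>k\<le>N. wt i * of_nat (expo w v k i) * (of_nat (m k) * pole m p + pole (m(k := Suc (m k))) p)))"
    by (intro sum.cong refl)
      (simp add: euler_op_gen[OF euler_op_lie_fun] distrib_right distrib_left sum_distrib_right sum.distrib mult.assoc)
  also have "\<dots> = pole m p * (\<Sum>i=1..5. wt i) + (\<Sum>k\<le>N. (\<Sum>i=1..5. of_nat (expo w v k i) * wt i)
      * (of_nat (m k) * pole m p + pole (m(k := Suc (m k))) p))"
    by (simp only: sum.distrib sum.swap[of _ "{..N}"] sum_distrib_left sum_distrib_right mult_ac)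
  also have "\<dots> = pole m p + (\<Sum>k\<le>N. of_nat (m k) * pole m p + pole (m(k := Suc (m k))) p)"
    by (intro arg_cong2[where f = "(+)"] sum.cong refl)
      (simp_all only: sum_wt sum_expo_wt atMost_iff mult_1 mult_1_right)
  also have "\<dots> = pole m p + of_nat (tdeg m) * pole m p + (\<Sum>k\<le>N. pole (m(k := Suc (m k))) p)"
    by (simp add: sum.distrib tdeg_def sum_distrib_right)
  also have "\<dots> = 0" by (simp add: sum_pole_raise algebra_simps)
  finally show ?case .
next
  case (add f g)
  have "(\<Sum>i=1..5. lie_fun i (\<lambda>p. f p + g p) p) = (\<Sum>i=1..5. lie_fun i f p + lie_fun i g p)"
    by (intro sum.cong refl fun_cong[OF euler_op_add] is_euler_opI[OF euler_op_lie_fun] add.hyps) auto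
  then show ?case using add by (simp add: sum.distrib)
next
  case (scale f c)
  have "(\<Sum>i=1..5. lie_fun i (\<lambda>p. c * f p) p) = (\<Sum>i=1..5. c * lie_fun i f p)"
    by (intro sum.cong refl fun_cong[OF euler_op_scale] is_euler_opI[OF euler_op_lie_fun] scale.hyps) auto
  then show ?case using scale by (simp add: sum_distrib_left[symmetric])
qed

text \<open>
The counterpart of \<open>A_half\<close>, applied to the factor of $\Omega_0$ in $\tilde\Pi$.
\<close>

definition A_fun :: "((nat \<times> nat) set \<Rightarrow> nat \<times> nat) \<Rightarrow> (nat \<Rightarrow> int) \<Rightarrow> nat \<Rightarrow> point \<times> point \<Rightarrow> complex" where
  "A_fun c l i p = (\<Sum>A | A \<subseteq> lie_factors N l \<and> A \<noteq> {} \<and> fst (c A) = i.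
     foldr (\<lambda>x. if x \<in> A then lie_fun (fst x) else theta_fun x) (remove1 (c A) (factors N l)) (pole (\<lambda>_. 0)) p)"

lemma is_euler_op_choice:
  assumes "A \<subseteq> lie_factors N l" "x \<in> set (factors N l)"
  shows "is_euler_op (if x \<in> A then lie_fun (fst x) else theta_fun x)"
proof (cases "x \<in> A")
  case True
  then have "fst x \<in> {1..5}" using assms(1) by (auto simp: lie_factors_def)
  then show ?thesis using True is_euler_opI[OF euler_op_lie_fun] by simp
next
  case False
  then show ?thesis
    using is_euler_opI[OF euler_op_theta_fun[OF fst_factors[OF assms(2)], of "snd x"]] by simp
qed

lemma A_fun_in_lin_span: "A_fun c l i \<in> lin_span"
proof -
  have "(\<lambda>p. \<Sum>A | A \<subseteq> lie_factors N l \<and> A \<noteq> {} \<and> fst (c A) = i.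
     foldr (\<lambda>x. if x \<in> A then lie_fun (fst x) else theta_fun x) (remove1 (c A) (factors N l)) (pole (\<lambda>_. 0)) p) \<in> lin_span"
  proof (rule sum_in_lin_span)
    fix A assume "A \<in> {A. A \<subseteq> lie_factors N l \<and> A \<noteq> {} \<and> fst (c A) = i}"
    then show "foldr (\<lambda>x. if x \<in> A then lie_fun (fst x) else theta_fun x) (remove1 (c A) (factors N l)) (pole (\<lambda>_. 0)) \<in> lin_span"
      using set_remove1_subset[of "c A" "factors N l"]
      by (intro foldr_euler_lin_span is_euler_op_choice lin_span.gen) auto
  qed
  then show ?thesis unfolding A_fun_def[abs_def] .
qed

text \<open>
Expanding the product of the corrected factors, the empty set gives the uncorrected product; from the
term of any other set \<open>A\<close> the operator of \<open>c A\<close> is moved to the front. Collecting the sets according to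
the index of \<open>c A\<close> yields the sum on the left.
\<close>

lemma sum_lie_fun_A_fun:
  assumes c: "\<forall>A. A \<noteq> {} \<longrightarrow> c A \<in> A"
  shows "(\<Sum>i=1..5. lie_fun i (A_fun c l i) p)
    = pole (pos_part l) p - foldr theta_fun (factors N l) (pole (\<lambda>_. 0)) p"
proof -
  let ?L = "lie_factors N l" and ?xs = "factors N l" and ?g = "pole (\<lambda>_. 0)"
  let ?h = "\<lambda>A x. if x \<in> A then lie_fun (fst x) else theta_fun x"
  have fin: "finite ?L" by (simp add: lie_factors_def)
  have cA: "c A \<in> ?L" "c A \<in> A" if "A \<subseteq> ?L" "A \<noteq> {}" for A using that c by auto
  have L: "x \<in> set ?xs" "fst x \<in> {1..5}" if "x \<in> ?L" for x using that by (auto simp: lie_factors_def)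
  have euler: "is_euler_op (?h A x)" if "A \<subseteq> ?L" "x \<in> set ?xs" for A x
    using is_euler_op_choice[OF that] .
  have "(\<Sum>i=1..5. lie_fun i (A_fun c l i) p)
      = (\<Sum>i=1..5. \<Sum>A | A \<in> Pow ?L - {{}} \<and> fst (c A) = i. foldr (?h A) ?xs ?g p)"
  proof (intro sum.cong refl)
    fix i :: nat assume i: "i \<in> {1..5}"
    let ?X = "{A. A \<subseteq> ?L \<and> A \<noteq> {} \<and> fst (c A) = i}"
    have "lie_fun i (A_fun c l i) = (\<lambda>p. \<Sum>A\<in>?X. lie_fun i (foldr (?h A) (remove1 (c A) ?xs) ?g) p)"
      unfolding A_fun_def[abs_def]
    proof (rule euler_op_sum)
      show "is_euler_op (lie_fun i)" by (rule is_euler_opI[OF euler_op_lie_fun[OF i]])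
      fix A assume "A \<in> ?X"
      then show "foldr (?h A) (remove1 (c A) ?xs) ?g \<in> lin_span"
        using set_remove1_subset[of "c A" ?xs]
        by (intro foldr_euler_lin_span is_euler_op_choice lin_span.gen) auto
    qed
    moreover have "lie_fun i (foldr (?h A) (remove1 (c A) ?xs) ?g) = foldr (?h A) ?xs ?g" if "A \<in> ?X" for A
    proof -
      have A: "A \<subseteq> ?L" "A \<noteq> {}" "fst (c A) = i" using that by auto
      have "foldr (?h A) ?xs ?g = ?h A (c A) (foldr (?h A) (remove1 (c A) ?xs) ?g)"
        by (rule foldr_euler_pull[OF euler[OF A(1)] lin_span.gen L(1)[OF cA(1)[OF A(1,2)]]])
      then show ?thesis using cA(2)[OF A(1,2)] A(3) by simp
    qed
    ultimately show "lie_fun i (A_fun c l i) p = (\<Sum>A | A \<in> Pow ?L - {{}} \<and> fst (c A) = i. foldr (?h A) ?xs ?g p)"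
      by (auto intro!: sum.cong)
  qed
  also have "\<dots> = (\<Sum>A\<in>Pow ?L - {{}}. foldr (?h A) ?xs ?g p)"
  proof (rule sum.group)
    show "(\<lambda>A. fst (c A)) ` (Pow ?L - {{}}) \<subseteq> {1..5}" using L(2)[OF cA(1)] by blast
  qed (use fin in auto)
  also have "\<dots> = (\<Sum>A\<in>Pow ?L. foldr (?h A) ?xs ?g p) - foldr (?h {}) ?xs ?g p"
    using fin by (subst sum_diff) auto
  also have "(\<Sum>A\<in>Pow ?L. foldr (?h A) ?xs ?g p) = foldr theta_hat ?xs ?g p"
  proof -
    have "?L = {x. fst x \<in> {1..5}} \<inter> set ?xs" by (auto simp: lie_factors_def)
    moreover have "foldr theta_hat ?xs ?g = (\<lambda>p. \<Sum>A\<in>Pow ({x. fst x \<in> {1..5}} \<inter> set ?xs). foldr (?h A) ?xs ?g p)"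
      unfolding theta_hat_def
    proof (rule foldr_euler_expand[OF distinct_factors _ _ lin_span.gen])
      show "is_euler_op (theta_fun x)" if "x \<in> set ?xs" for x
        using is_euler_op_choice[of "{}" l x] that by simp
      show "is_euler_op (lie_fun (fst x))" if "x \<in> {x. fst x \<in> {1..5}}" for x :: "nat \<times> nat"
        using is_euler_opI[OF euler_op_lie_fun] that by simp
    qed
    ultimately show ?thesis by simp
  qed
  also have "foldr theta_hat ?xs ?g p = pole (pos_part l) p" by (simp only: foldr_raise_factors)
  finally show ?thesis by simp
qed


section \<open>From scalar functions to forms\<close>

text \<open>
The rescaling is diagonal, so the pullback multiplies each component by a product of the
$\lambda_\rho$; together with the factor $\lambda_\rho$ from the coefficient $z_\rho$ of
$\Omega_0$ this is always the full product $\lambda_1\cdots\lambda_5$.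
\<close>

lemma Pi_tilde_eq:
  assumes d: "(b, z) \<in> regular" and J: "J \<in> idx 4"
  shows "Pi_tilde w N v lg b J z = pole (\<lambda>_. 0) (b, z) * Omega0 w J z"
proof -
  have len: "length J = 4" using J by (simp add: idx_def)
  have phi: "phi1 w lg b y \<rho> = lam b \<rho> * y \<rho>" for y \<rho>
    by (simp add: phi1_def lam_def wt_def)
  have pd_phi: "pd j (\<lambda>y. phi1 w lg b y i) z = lam b i * (if i = j then 1 else 0)" for i j
    unfolding phi by (intro pd_DERIV DERIV_cmult fun_upd_coord_DERIV)
  let ?\<Pi> = "Pi_form w N v b"
  have "pullback (phi1 w lg b) ?\<Pi> J z
      = (\<Sum>I\<in>idx 4. if I = J then (\<Prod>p<4. lam b (J ! p)) * ?\<Pi> J (phi1 w lg b z) else 0)"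
    unfolding pullback_def len pd_phi
  proof (intro sum.cong refl)
    fix I assume "I \<in> idx 4"
    then have "length I = 4" by (simp add: idx_def)
    moreover have "(\<Prod>p<4. lam b (I ! p) * (if I ! p = J ! p then 1 else 0)) = 0" if "I \<noteq> J"
    proof -
      have "\<exists>p<4. I ! p \<noteq> J ! p"
        by (rule ccontr) (use that \<open>length I = 4\<close> len in \<open>auto intro: nth_equalityI\<close>)
      then obtain p where "p < 4" "I ! p \<noteq> J ! p" by blast
      then show ?thesis by (intro prod_zero) auto
    qed
    ultimately show "(\<Prod>p<4. lam b (I ! p) * (if I ! p = J ! p then 1 else 0)) * ?\<Pi> I (phi1 w lg b z)
       = (if I = J then (\<Prod>p<4. lam b (J ! p)) * ?\<Pi> J (phi1 w lg b z) else 0)"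
      by simp
  qed
  also have "\<dots> = (\<Prod>p<4. lam b (J ! p)) * ?\<Pi> J (phi1 w lg b z)"
    using J finite_lists_length_eq[of "{1..5::nat}" 4]
    by (simp add: idx_def conj_commute)
  also have "\<dots> = (\<Prod>p<4. lam b (J ! p)) * Omega0 w J (phi1 w lg b z) / Q (b, z)"
    by (simp add: Pi_form_def denom_eq_Q)
  also have "(\<Prod>p<4. lam b (J ! p)) * Omega0 w J (phi1 w lg b z) = (\<Prod>\<rho>=1..5. lam b \<rho>) * Omega0 w J z"
  proof -
    have "(\<Prod>p<4. lam b (J ! p)) * (lam b \<rho> * vol (\<rho> # J)) = (\<Prod>\<rho>=1..5. lam b \<rho>) * vol (\<rho> # J)" for \<rho>
    proof (cases "vol (\<rho> # J) = 0")
      case False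
      have "(\<Prod>p<4. lam b (J ! p)) = prod_list (map (lam b) J)"
        by (simp add: prod.list_conv_set_nth len atLeast0LessThan)
      then have "lam b \<rho> * (\<Prod>p<4. lam b (J ! p)) = prod_list (map (lam b) (\<rho> # J))"
        by simp
      also have "\<dots> = prod_mset (image_mset (lam b) (mset (\<rho> # J)))"
        by (simp only: prod_mset_prod_list flip: mset_map)
      also have "\<dots> = prod_list (map (lam b) [1..<6])"
        unfolding vol_nonzeroD[OF False] by (simp only: prod_mset_prod_list flip: mset_map)
      also have "\<dots> = (\<Prod>\<rho>\<in>set [1..<6]. lam b \<rho>)"
        by (rule prod.distinct_set_conv_list[symmetric]) simp
      also have "set [1..<6] = {1..5::nat}" by auto
      finally have "lam b \<rho> * (\<Prod>p<4. lam b (J ! p)) = (\<Prod>\<rho>=1..5. lam b \<rho>)" .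
      then show ?thesis by (simp only: mult_ac)
    qed simp
    then have "(\<Prod>p<4. lam b (J ! p)) * (of_nat (w \<rho>) * (lam b \<rho> * z \<rho>) * vol (\<rho> # J))
        = (\<Prod>\<rho>=1..5. lam b \<rho>) * (of_nat (w \<rho>) * z \<rho> * vol (\<rho> # J))" for \<rho>
      by (simp only: mult_ac)
    then show ?thesis
      unfolding Omega0_eq_contract_vol phi sum_distrib_left by (simp only:)
  qed
  finally show ?thesis
    using d by (simp add: Pi_tilde_def pole_def tdeg_def pref_def)
qed

text \<open>
The dictionary between families of forms and scalar functions. It says nothing off the
regular locus, which is harmless because that locus is open along coordinate lines.
\<close>

definition represents :: "family \<Rightarrow> (point \<times> point \<Rightarrow> complex) \<Rightarrow> bool" where
  "represents F f \<longleftrightarrow> (\<forall>b z. \<forall>I\<in>idx 4. (b, z) \<in> regular \<longrightarrow> F b I z = f (b, z) * Omega0 w I z)"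

text \<open>
The same for a single form at fixed parameters. This is needed because $\alpha_i$ contains the
monomial $a^l$, which is constant only as long as the parameters do not move.
\<close>

definition represents_at :: "point \<Rightarrow> form \<Rightarrow> (point \<times> point \<Rightarrow> complex) \<Rightarrow> bool" where
  "represents_at b \<omega> f \<longleftrightarrow> (\<forall>z. \<forall>I\<in>idx 4. (b, z) \<in> regular \<longrightarrow> \<omega> I z = f (b, z) * Omega0 w I z)"

lemma representsD:
  "represents F f \<Longrightarrow> (b, z) \<in> regular \<Longrightarrow> I \<in> idx 4 \<Longrightarrow> F b I z = f (b, z) * Omega0 w I z"
  unfolding represents_def by blast

lemma represents_atD:
  "represents_at b \<omega> f \<Longrightarrow> (b, z) \<in> regular \<Longrightarrow> I \<in> idx 4 \<Longrightarrow> \<omega> I z = f (b, z) * Omega0 w I z"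
  unfolding represents_at_def by blast

lemma represents_at_ev:
  assumes "represents_at b \<omega> f" "(b, z) \<in> regular" "I \<in> idx 4" "i \<in> {1..5}"
  shows "\<forall>\<^sub>F t in nhds (z i). \<omega> I (z(i := t)) = f (b, z(i := t)) * Omega0 w I (z(i := t))"
  using eventually_regular_z[OF assms(2,4)]
  by eventually_elim (rule represents_atD[OF assms(1) _ assms(3)])

lemma lie_represents_at:
  assumes "represents_at b \<omega> f" "f \<in> lin_span" "i \<in> {1..5}"
  shows "represents_at b (lie (euler_field w i) \<omega>) (lie_fun i f)"
  unfolding represents_at_def
proof (intro allI ballI impI)
  fix z I assume I: "I \<in> idx 4" and d: "(b, z) \<in> regular"
  show "lie (euler_field w i) \<omega> I z = lie_fun i f (b, z) * Omega0 w I z"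
    using lie_euler_field_Omega0[where g = "\<lambda>z. f (b, z)" and z = z and i = i and \<omega> = \<omega> and I = I and w = w, OF assms(3)
        represents_at_ev[OF assms(1) d I assms(3)] lin_span_DERIV_z[OF assms(2) d assms(3)]] d
    by (simp add: lie_fun_def wt_def)
qed

lemma represents_lie:
  assumes "represents F f" "f \<in> lin_span" "i \<in> {1..5}"
  shows "represents (lie_op w i F) (lie_fun i f)"
  using lie_represents_at[OF _ assms(2,3)] assms(1)
  unfolding represents_def represents_at_def lie_op_def by blast

text \<open>
$\Omega_0$ is independent of the parameters.
\<close>

lemma represents_theta:
  assumes F: "represents F f" and f: "f \<in> lin_span" and i: "fst x \<le> N"
  shows "represents (theta_shift x F) (theta_fun x f)"
  unfolding represents_def
proof (intro allI ballI impI)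
  fix b z I assume I: "I \<in> idx 4" and d: "(b, z) \<in> regular"
  obtain i j where x: "x = (i, j)" by (cases x)
  have "\<forall>\<^sub>F t in nhds (b i). F (b(i := t)) I z = f (b(i := t), z) * Omega0 w I z"
    using eventually_regular_b[OF d, of i] i x
    by (auto elim!: eventually_mono intro: representsD[OF F _ I])
  moreover have "((\<lambda>t. f (b(i := t), z) * Omega0 w I z) has_field_derivative
      pd i (\<lambda>b. f (b, z)) b * Omega0 w I z) (at (b i))"
    using i x by (intro DERIV_cmult_right lin_span_DERIV_b f d) simp
  ultimately have "pd i (\<lambda>b. F b I z) b = pd i (\<lambda>b. f (b, z)) b * Omega0 w I z"
    by (rule pd_eqI[where f = "\<lambda>b. F b I z"])
  then show "theta_shift x F b I z = theta_fun x f (b, z) * Omega0 w I z"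
    using d by (simp add: x theta_shift_def theta_fun_def representsD[OF F d I] algebra_simps)
qed

lemma represents_foldr:
  assumes "\<And>x F f. x \<in> set xs \<Longrightarrow> represents F f \<Longrightarrow> f \<in> lin_span \<Longrightarrow> represents (g x F) (h x f)"
    "\<And>x. x \<in> set xs \<Longrightarrow> is_euler_op (h x)" "represents F f" "f \<in> lin_span"
  shows "represents (foldr g xs F) (foldr h xs f)"
  using assms(1,2)
proof (induction xs)
  case (Cons x xs)
  have "foldr h xs f \<in> lin_span" using Cons.prems(2) assms(4) by (intro foldr_euler_lin_span) auto
  then show ?case using Cons by simp
qed (simp add: assms)

lemma represents_Pi_tilde: "represents (Pi_tilde w N v lg) (pole (\<lambda>_. 0))"
  unfolding represents_def using Pi_tilde_eq by blast

lemma represents_gkz_half: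
  "represents (gkz_half N l (Pi_tilde w N v lg)) (foldr theta_fun (factors N l) (pole (\<lambda>_. 0)))"
  unfolding gkz_half_def compose_ops_map
proof (rule represents_foldr[OF _ _ represents_Pi_tilde lin_span.gen])
  fix x assume "x \<in> set (factors N l)"
  then show "is_euler_op (theta_fun x)" using is_euler_op_choice[of "{}" l x] by simp
qed (rule represents_theta, auto dest: fst_factors)

lemma represents_A_half: "represents (A_half w N c l i (Pi_tilde w N v lg)) (A_fun c l i)"
proof -
  let ?g = "\<lambda>A p. if p \<in> A then lie_op w (fst p) else theta_shift p"
  let ?h = "\<lambda>A x. if x \<in> A then lie_fun (fst x) else theta_fun x"
  have "represents (foldr (?g A) (remove1 (c A) (factors N l)) (Pi_tilde w N v lg))
      (foldr (?h A) (remove1 (c A) (factors N l)) (pole (\<lambda>_. 0)))" if A: "A \<subseteq> lie_factors N l" for A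
  proof (rule represents_foldr[OF _ _ represents_Pi_tilde lin_span.gen])
    fix x assume "x \<in> set (remove1 (c A) (factors N l))"
    then have x: "x \<in> set (factors N l)" using set_remove1_subset by fast
    show "is_euler_op (?h A x)" by (rule is_euler_op_choice[OF A x])
    fix F f assume "represents F f" "f \<in> lin_span"
    then show "represents (?g A x F) (?h A x f)"
      using A fst_factors[OF x] by (auto simp: lie_factors_def intro!: represents_lie represents_theta)
  qed
  then show ?thesis
    unfolding represents_def A_half_def A_fun_def compose_ops_map sum_distrib_right
    by (intro allI ballI impI sum.cong refl) simp
qed

text \<open>
The factor of $\Omega_0$ in $\alpha_i$ at the parameter \<open>a\<close>. The parameter in the monomial $a^l$ is kept separate
from the one in \<open>p\<close>, so that this function lies in the span.
\<close>

definition alpha_fun :: "((nat \<times> nat) set \<Rightarrow> nat \<times> nat) \<Rightarrow> (nat \<Rightarrow> int) \<Rightarrow> point \<Rightarrow> nat \<Rightarrow> point \<times> point \<Rightarrow> complex" where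
  "alpha_fun c l a i p = A_fun c l i p + (- lmonom N l a) * A_fun c (\<lambda>j. - l j) i p"

lemma alpha_fun_in_lin_span: "alpha_fun c l a i \<in> lin_span"
  unfolding alpha_fun_def[abs_def] by (intro lin_span.add lin_span.scale A_fun_in_lin_span)

lemma represents_at_alpha: "represents_at a (alpha w N v lg c l i a) (alpha_fun c l a i)"
  unfolding represents_at_def alpha_def A_op_def alpha_fun_def
  by (simp add: representsD[OF represents_A_half] algebra_simps)

text \<open>
By the divergence formula, the factor of the volume form in $d(f\,\Omega_0)$ is $d\sum_i\mathcal L_i$ applied
to $f$.
\<close>

lemma closed_represents_at:
  assumes "represents_at b \<omega> f" "f \<in> lin_span" "(b, z) \<in> regular" "I \<in> idx 5"
  shows "ext_d \<omega> I z = 0"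
proof -
  let ?g' = "\<lambda>i. pd i (\<lambda>z. f (b, z)) z"
  have "ext_d \<omega> I z = vol I * (\<Sum>i=1..5. of_nat (w i) * (z i * ?g' i + f (b, z)))"
    using assms by (intro ext_d_Omega0[where g = "\<lambda>z. f (b, z)"] represents_at_ev lin_span_DERIV_z) auto
  also have "(\<Sum>i=1..5. of_nat (w i) * (z i * ?g' i + f (b, z)))
      = of_nat (total_wt w) * (\<Sum>i=1..5. lie_fun i f (b, z))"
    using total_wt_nz assms(3) by (simp add: sum_distrib_left lie_fun_def wt_def)
  finally show ?thesis by (simp only: sum_lie_fun_eq_0[OF assms(2)] mult_zero_right)
qed

lemma represents_at_differentiable:
  assumes "represents_at b \<omega> f" "f \<in> lin_span" "(b, z) \<in> regular" "J \<in> idx 4" "i \<in> {1..5}"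
  shows "(\<lambda>t. \<omega> J (z(i := t))) field_differentiable at (z i)"
  using DERIV_cong_ev[OF refl represents_at_ev[OF assms(1,3,4,5)] refl]
    DERIV_mult[OF lin_span_DERIV_z[OF assms(2,3,5)] Omega0_DERIV[of w J z i]]
  unfolding field_differentiable_def by blast

lemma euler_field_differentiable:
  "(\<lambda>t. euler_field w i m (z(j := t))) field_differentiable at (z j)"
  unfolding euler_field_def
  by (cases "m = i"; cases "i = j") (use fermat_total_wt_pos[OF fermat] in \<open>auto intro!: derivative_intros\<close>)

text \<open>
Cartan's formula for a closed form.
\<close>

lemma lie_eq_ext_d_contract:
  assumes "represents_at b \<omega> f" "f \<in> lin_span" "(b, z) \<in> regular" "I \<in> idx 4"
  shows "lie (euler_field w i) \<omega> I z = ext_d (contract (euler_field w i) \<omega>) I z"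
proof -
  have "lie (euler_field w i) \<omega> I z
      = ext_d (contract (euler_field w i) \<omega>) I z + contract (euler_field w i) (ext_d \<omega>) I z"
  proof (rule cartan_formula[OF assms(4)])
    fix p m :: nat assume pm: "p < 4" "m \<in> {1..5}"
    note mem = idx_del_insert[OF assms(4) pm]
    have "length I = 4" using assms(4) by (simp add: idx_def)
    then show "\<omega> (I[p := m]) z = (-1) ^ p * \<omega> (m # take p I @ drop (Suc p) I) z"
      unfolding represents_atD[OF assms(1,3) mem(1)] represents_atD[OF assms(1,3) mem(2)]
      using alternating_replace[OF alternating_Omega0[of w z], of p I m] pm by simp
  qed (auto intro: represents_at_differentiable[OF assms(1,2,3)] euler_field_differentiable)
  moreover have "contract (euler_field w i) (ext_d \<omega>) I z = 0"
    unfolding contract_def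
  proof (intro sum.neutral ballI)
    fix m :: nat assume "m \<in> {1..5}"
    then have "m # I \<in> idx 5" using assms(4) by (auto simp: idx_def)
    then show "euler_field w i m z * ext_d \<omega> (m # I) z = 0"
      using closed_represents_at[OF assms(1,2,3)] by simp
  qed
  ultimately show ?thesis by simp
qed

lemma contract_differentiable:
  assumes "represents_at b \<omega> f" "f \<in> lin_span" "(b, z) \<in> regular" "J \<in> idx 3" "j \<in> {1..5}"
  shows "(\<lambda>t. contract (euler_field w i) \<omega> J (z(j := t))) field_differentiable at (z j)"
  unfolding contract_def
proof (intro field_differentiable_sum field_differentiable_mult euler_field_differentiable)
  fix m :: nat assume "m \<in> {1..5}"
  then have "m # J \<in> idx 4" using assms(4) by (auto simp: idx_def)
  then show "(\<lambda>t. \<omega> (m # J) (z(j := t))) field_differentiable at (z j)"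
    by (rule represents_at_differentiable[OF assms(1,2,3) _ assms(5)])
qed

lemma D_tilde_Pi_tilde:
  assumes l: "l \<in> relation_lattice N v" and c: "\<forall>A. A \<noteq> {} \<longrightarrow> c A \<in> A"
    and d: "(a, z) \<in> regular" and I: "I \<in> idx 4"
  shows "D_tilde N l (Pi_tilde w N v lg) a I z
    = - (\<Sum>i=1..5. lie (euler_field w i) (alpha w N v lg c l i a) I z)"
proof -
  let ?half = "\<lambda>l. foldr theta_fun (factors N l) (pole (\<lambda>_. 0)) (a, z)"
  let ?n = "\<lambda>j. - l j"
  have "(\<Sum>i=1..5. lie (euler_field w i) (alpha w N v lg c l i a) I z)
      = (\<Sum>i=1..5. lie_fun i (alpha_fun c l a i) (a, z)) * Omega0 w I z"
    unfolding sum_distrib_right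
    by (intro sum.cong refl represents_atD[OF lie_represents_at[OF represents_at_alpha alpha_fun_in_lin_span] d I]) 
  also have "(\<Sum>i=1..5. lie_fun i (alpha_fun c l a i) (a, z))
      = (\<Sum>i=1..5. lie_fun i (A_fun c l i) (a, z) + (- lmonom N l a) * lie_fun i (A_fun c ?n i) (a, z))"
  proof (intro sum.cong refl)
    fix i :: nat assume "i \<in> {1..5}"
    then have e: "is_euler_op (lie_fun i)" by (rule is_euler_opI[OF euler_op_lie_fun])
    show "lie_fun i (alpha_fun c l a i) (a, z)
        = lie_fun i (A_fun c l i) (a, z) + (- lmonom N l a) * lie_fun i (A_fun c ?n i) (a, z)"
      unfolding alpha_fun_def[abs_def]
      by (simp only: euler_op_add[OF e A_fun_in_lin_span lin_span.scale[OF A_fun_in_lin_span]] euler_op_scale[OF e A_fun_in_lin_span])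
  qed
  also have "\<dots> = (pole (pos_part l) (a, z) - ?half l)
      + (- lmonom N l a) * (pole (pos_part ?n) (a, z) - ?half ?n)"
    by (simp only: sum.distrib sum_distrib_left[symmetric] sum_lie_fun_A_fun[OF c])
  also have "\<dots> = - (?half l - lmonom N l a * ?half ?n)"
    unfolding pole_lattice[OF l] by (simp add: algebra_simps)
  finally show ?thesis
    unfolding D_tilde_def representsD[OF represents_gkz_half d I] by (simp add: algebra_simps)
qed

lemma ext_d_beta:
  assumes d: "(a, z) \<in> regular" and I: "I \<in> idx 4"
  shows "ext_d (beta w N v lg c l a) I z
    = (\<Sum>i=1..5. lie (euler_field w i) (alpha w N v lg c l i a) I z)"
proof -
  have "ext_d (beta w N v lg c l a) I z
      = (\<Sum>i=1..5. ext_d (contract (euler_field w i) (alpha w N v lg c l i a)) I z)"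
    unfolding beta_def[abs_def]
  proof (rule ext_d_sum)
    fix i p assume "p < length I"
    then have p: "p < 4" using I by (simp add: idx_def)
    have "take p I @ drop (Suc p) I \<in> idx 3"
      using idx_del_insert(1)[OF I p, of 1] by (simp add: idx_def)
    then show "(\<lambda>t. contract (euler_field w i) (alpha w N v lg c l i a) (take p I @ drop (Suc p) I)
        (z(I ! p := t))) field_differentiable at (z (I ! p))"
      using idx_del_insert(3)[OF I p, of 1]
      by (intro contract_differentiable[OF represents_at_alpha alpha_fun_in_lin_span d]) auto
  qed
  then show ?thesis
    by (simp add: lie_eq_ext_d_contract[OF represents_at_alpha alpha_fun_in_lin_span d I])
qed

end


section \<open>The theorem\<close>

theorem proposition3p2:
  fixes w :: "nat \<Rightarrow> nat"
    and N :: nat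
    and v :: "nat \<Rightarrow> real ^ 4"
    and U :: "(nat \<Rightarrow> complex) set"
    and lg :: "nat \<Rightarrow> (nat \<Rightarrow> complex) \<Rightarrow> complex"
    and l :: "nat \<Rightarrow> int"
    and c :: "(nat \<times> nat) set \<Rightarrow> nat \<times> nat"
    and a z :: "nat \<Rightarrow> complex"
  assumes "fermat_weights w"
    and "enumerates_integral_points w N v"
    and "open U"
    and "\<forall>b\<in>U. \<forall>i\<le>N. b i \<noteq> 0"
    and "log_branches U lg"
    and "l \<in> relation_lattice N v"
    and "\<forall>S. S \<noteq> {} \<longrightarrow> c S \<in> S"
    and "a \<in> U"
    and "denom w N v a (phi1 w lg a z) \<noteq> 0"
  shows "(\<forall>i\<in>{1..5}. \<forall>I\<in>idx 5. ext_d (alpha w N v lg c l i a) I z = 0)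
       \<and> (\<forall>I\<in>idx 4. D_tilde N l (Pi_tilde w N v lg) a I z
            = - (\<Sum>i=1..5. lie (euler_field w i) (alpha w N v lg c l i a) I z))
       \<and> (\<forall>I\<in>idx 4. D_tilde N l (Pi_tilde w N v lg) a I z
            = - ext_d (beta w N v lg c l a) I z)"
proof -
  interpret fermat_family w N v U lg
    using assms(1-5) by unfold_locales
  have d: "(a, z) \<in> regular"
    using assms(8,9) by (simp add: regular_def denom_eq_Q)
  show ?thesis
    using closed_represents_at[OF represents_at_alpha alpha_fun_in_lin_span d]
      D_tilde_Pi_tilde[OF assms(6,7) d] ext_d_beta[OF d] by simp
qed

end
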